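(* Suppose that $N$ is an $\omega$-saturated structure $0$-expanding a structure $M$ that expands an abelian group $(G,+)$ with small quotients. Let $f: G\to G$ be a group homomorphism definable in $N$. If there exists a finite set $F\subseteq G$ such that for every $g\in G$, $f(g)\in \operatorname{acl}_M(F\cup\{g\})$, then $f$ is definable in $M$. In particular, if $\operatorname{dcl}_N(A)\subseteq \operatorname{acl}_M(A)$ for every $A\subseteq G$, then every group homomorphism $f:G\to G$ definable in $N$ is definable in $M$.
   Context: "Definable" without a specified parameter set means definable with parameters from the structure. For structures $M,N$ with the same universe and a subset $A$ of that universe, $M$ is an $A$-reduct of $N$ (equivalently $N$ is an $A$-expansion of $M$) if every $X\subseteq M^k$ (any $k$) that is $\emptyset$-definable in $M$ is $A$-definable in $N$. When $A$ is the whole universe one says reduct/expansion; when $A=\emptyset$ one says $0$-reduct/$0$-expansion (and "$N$ $0$-expands $M$"). A structure expands a group $(G,+)$ if it is an expansion of the structure $(G,+)$; in particular its universe is $G$. An abelian group $(G,+)$ has small quotients if for all $1\le n<\omega$ the index $[G:nG]$ is finite. $\operatorname{acl}_M$ and $\operatorname{dcl}_N$ denote model-theoretic algebraic closure in $M$ and definable closure in $N$ (in the home sort). *)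

theory Defs
  imports Complex_Main
begin

text \<open>
  First-order structures with equality over an arbitrary language. The universe is the whole
  type \<open>'a\<close>; \<open>'f\<close> and \<open>'r\<close> are the types that function and relation symbols are drawn from.
  The language is part of the structure. It is given by subsets of these types, since a type is
  never empty but a language may have no function symbols or no relation symbols. The values of
  \<open>fun_int\<close> and \<open>rel_int\<close> on symbols outside the language, or on argument lists of
  the wrong length, play no role.
\<close>

record ('f, 'r, 'a) fo_structure =
  fun_syms  :: "'f set"
  fun_arity :: "'f \<Rightarrow> nat"
  fun_int   :: "'f \<Rightarrow> 'a list \<Rightarrow> 'a"
  rel_syms  :: "'r set"
  rel_arity :: "'r \<Rightarrow> nat"
  rel_int   :: "'r \<Rightarrow> 'a list \<Rightarrow> bool"

datatype 'f tm = Var nat | App 'f "'f tm list"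

datatype ('f, 'r) fm =
    Equal "'f tm" "'f tm"
  | Rel 'r "'f tm list"
  | Neg "('f, 'r) fm"
  | Conj "('f, 'r) fm" "('f, 'r) fm"
  | Exist nat "('f, 'r) fm"

fun tm_in :: "('f, 'r, 'a) fo_structure \<Rightarrow> 'f tm \<Rightarrow> bool" where
  "tm_in M (Var i) = True"
| "tm_in M (App h ts) =
     (h \<in> fun_syms M \<and> length ts = fun_arity M h \<and> (\<forall>t\<in>set ts. tm_in M t))"

primrec fm_in :: "('f, 'r, 'a) fo_structure \<Rightarrow> ('f, 'r) fm \<Rightarrow> bool" where
  "fm_in M (Equal s t) = (tm_in M s \<and> tm_in M t)"
| "fm_in M (Rel R ts) =
     (R \<in> rel_syms M \<and> length ts = rel_arity M R \<and> (\<forall>t\<in>set ts. tm_in M t))"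
| "fm_in M (Neg \<phi>) = fm_in M \<phi>"
| "fm_in M (Conj \<phi> \<psi>) = (fm_in M \<phi> \<and> fm_in M \<psi>)"
| "fm_in M (Exist i \<phi>) = fm_in M \<phi>"

fun tm_vars :: "'f tm \<Rightarrow> nat set" where
  "tm_vars (Var i) = {i}"
| "tm_vars (App h ts) = (\<Union>t\<in>set ts. tm_vars t)"

primrec free_vars :: "('f, 'r) fm \<Rightarrow> nat set" where
  "free_vars (Equal s t) = tm_vars s \<union> tm_vars t"
| "free_vars (Rel R ts) = (\<Union>t\<in>set ts. tm_vars t)"
| "free_vars (Neg \<phi>) = free_vars \<phi>"
| "free_vars (Conj \<phi> \<psi>) = free_vars \<phi> \<union> free_vars \<psi>"
| "free_vars (Exist i \<phi>) = free_vars \<phi> - {i}"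

primrec tm_val :: "('f, 'r, 'a) fo_structure \<Rightarrow> (nat \<Rightarrow> 'a) \<Rightarrow> 'f tm \<Rightarrow> 'a" where
  "tm_val M e (Var i) = e i"
| "tm_val M e (App h ts) = fun_int M h (map (tm_val M e) ts)"

primrec sat :: "('f, 'r, 'a) fo_structure \<Rightarrow> (nat \<Rightarrow> 'a) \<Rightarrow> ('f, 'r) fm \<Rightarrow> bool" where
  "sat M e (Equal s t) = (tm_val M e s = tm_val M e t)"
| "sat M e (Rel R ts) = rel_int M R (map (tm_val M e) ts)"
| "sat M e (Neg \<phi>) = (\<not> sat M e \<phi>)"
| "sat M e (Conj \<phi> \<psi>) = (sat M e \<phi> \<and> sat M e \<psi>)"
| "sat M e (Exist i \<phi>) = (\<exists>a. sat M (e(i := a)) \<phi>)"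

text \<open>
  Elements of the \<open>k\<close>-th Cartesian power of the universe are lists of length \<open>k\<close>. In
  \<open>\<phi>(x, c)\<close> the variables \<open>0, \<dots>, k - 1\<close> stand for the tuple \<open>x\<close> and the next
  \<open>length c\<close> variables for the parameters \<open>c\<close>.
\<close>

definition definable_over ::
    "('f, 'r, 'a) fo_structure \<Rightarrow> 'a set \<Rightarrow> nat \<Rightarrow> 'a list set \<Rightarrow> bool" where
  "definable_over M A k X \<longleftrightarrow>
     (\<exists>\<phi> cs. fm_in M \<phi> \<and> set cs \<subseteq> A \<and> free_vars \<phi> \<subseteq> {..<k + length cs} \<and>
        X = {xs. length xs = k \<and> sat M ((!) (xs @ cs)) \<phi>})"

definition definable_map :: "('f, 'r, 'a) fo_structure \<Rightarrow> ('a \<Rightarrow> 'a) \<Rightarrow> bool" where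
  "definable_map M f \<longleftrightarrow> definable_over M UNIV 2 {[x, f x] |x. True}"

definition acl :: "('f, 'r, 'a) fo_structure \<Rightarrow> 'a set \<Rightarrow> 'a set" where
  "acl M A = {b. \<exists>X. definable_over M A 1 X \<and> finite X \<and> [b] \<in> X}"

definition dcl :: "('f, 'r, 'a) fo_structure \<Rightarrow> 'a set \<Rightarrow> 'a set" where
  "dcl M A = {b. definable_over M A 1 {[b]}}"

definition is_expansion_over ::
    "'a set \<Rightarrow> ('f, 'r, 'a) fo_structure \<Rightarrow> ('g, 's, 'a) fo_structure \<Rightarrow> bool" where
  "is_expansion_over A N M \<longleftrightarrow>
     (\<forall>k X. definable_over M {} k X \<longrightarrow> definable_over N A k X)"

abbreviation is_expansion ::
    "('f, 'r, 'a) fo_structure \<Rightarrow> ('g, 's, 'a) fo_structure \<Rightarrow> bool" where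
  "is_expansion \<equiv> is_expansion_over UNIV"

abbreviation is_zero_expansion ::
    "('f, 'r, 'a) fo_structure \<Rightarrow> ('g, 's, 'a) fo_structure \<Rightarrow> bool" where
  "is_zero_expansion \<equiv> is_expansion_over {}"

text \<open>
  Every finitely satisfiable set of formulas in one variable over a finite parameter set is
  realized. The list \<open>cs\<close> enumerates the parameters; variable \<open>0\<close> is the variable of the type.
\<close>

definition omega_saturated :: "('f, 'r, 'a) fo_structure \<Rightarrow> bool" where
  "omega_saturated M \<longleftrightarrow>
     (\<forall>cs p. (\<forall>\<phi>\<in>p. fm_in M \<phi> \<and> free_vars \<phi> \<subseteq> {..<Suc (length cs)}) \<longrightarrow>
        (\<forall>q\<subseteq>p. finite q \<longrightarrow> (\<exists>a. \<forall>\<phi>\<in>q. sat M ((!) (a # cs)) \<phi>)) \<longrightarrow>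
        (\<exists>a. \<forall>\<phi>\<in>p. sat M ((!) (a # cs)) \<phi>))"

text \<open>The structure \<open>(G, +)\<close>, whose only symbol is the binary function symbol for addition.\<close>

definition group_structure :: "(unit, unit, 'a::ab_group_add) fo_structure" where
  "group_structure =
     \<lparr>fun_syms = {()}, fun_arity = (\<lambda>_. 2), fun_int = (\<lambda>_ xs. xs ! 0 + xs ! 1),
      rel_syms = {}, rel_arity = (\<lambda>_. 0), rel_int = (\<lambda>_ _. False)\<rparr>"

text \<open>\<open>nG = {ng | g \<in> G}\<close>, where \<open>ng\<close> is the \<open>n\<close>-fold sum of \<open>g\<close>.\<close>

definition multiples :: "nat \<Rightarrow> 'a::ab_group_add set" where
  "multiples n = range (\<lambda>g. \<Sum>i<n. g)"

text \<open>For every \<open>n \<ge> 1\<close> there are only finitely many cosets \<open>x + nG\<close>.\<close>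

definition small_quotients :: "'a::ab_group_add itself \<Rightarrow> bool" where
  "small_quotients (_ :: 'a itself) \<longleftrightarrow>
     (\<forall>n\<ge>1. finite (range (\<lambda>x::'a. (+) x ` multiples n)))"

end

theory Submission
  imports Defs "HOL-Analysis.Function_Topology"
begin

text \<open>
  Let \<open>f\<close> be an additive map definable in \<open>N\<close> with \<open>f g \<in> acl M (F \<union> {g})\<close> for all \<open>g\<close>.

  By saturation the algebraicity is uniform (\<open>uniformly_algebraic\<close>): there is one relation \<open>R\<close>,
  definable in \<open>M\<close>, whose fibres have at most \<open>m\<close> elements for some \<open>m\<close>, and which contains the
  graph of \<open>f\<close>.

  Now consider all homomorphisms \<open>u\<close> whose graph is contained in \<open>R\<close>. If many of them had pairwise
  differences with large range, then the kernels of these differences would have large index, and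
  by a counting argument in the style of B. H. Neumann (\<open>ex_nonzero_of_large_ranges\<close>) some point
  would avoid all the kernels. There the homomorphisms would take more than \<open>m\<close> values in one
  fibre of \<open>R\<close>. So up to differences with small finite range there are only finitely many such
  homomorphisms, and a homomorphism with small finite range vanishes on \<open>nG\<close> for a suitable
  \<open>n \<ge> 1\<close>. Consequently there is a finite set \<open>T\<close> such that every homomorphism through \<open>R\<close> that
  agrees with \<open>f\<close> on \<open>T\<close> agrees with \<open>f\<close> on \<open>nG\<close> (\<open>finite_test_set\<close>).

  This characterizes \<open>f\<close> on \<open>nG\<close> in terms of \<open>R\<close>, addition and the finitely many parameters in
  \<open>T\<close> and \<open>f ` T\<close>: we have \<open>y = f (na)\<close> iff there is a homomorphism through \<open>R\<close> that agrees with
  \<open>f\<close> on \<open>T\<close> and takes the value \<open>y\<close> at \<open>na\<close>. Since the fibres are finite, Tychonoff's theorem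
  (\<open>ex_hom_selection\<close>) replaces the existence of a homomorphism by a sequence of first-order
  conditions about \<open>k\<close>-tuples. Each condition is definable in \<open>M\<close>, the graph of \<open>f\<close> on \<open>nG\<close> is
  their intersection and is definable in \<open>N\<close>, and so by saturation of \<open>N\<close> a single \<open>k\<close> suffices
  (\<open>definable_on_multiples\<close>). Finally \<open>nG\<close> has finite index, so \<open>f\<close> is determined by its
  restriction to \<open>nG\<close> and its values at finitely many coset representatives
  (\<open>definable_of_definable_on_multiples\<close>).
\<close>

section \<open>Closure properties of definable predicates\<close>

lemma finite_tm_vars: "finite (tm_vars t)"
  by (induction t) auto

lemma finite_free_vars: "finite (free_vars \<phi>)"
  by (induction \<phi>) (auto simp: finite_tm_vars)

lemma tm_val_cong: "(\<And>i. i \<in> tm_vars t \<Longrightarrow> e i = e' i) \<Longrightarrow> tm_val M e t = tm_val M e' t"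
proof (induction t)
  case (App h ts)
  then have "map (tm_val M e) ts = map (tm_val M e') ts"
    by (intro map_cong) auto
  then show ?case by (simp only: tm_val.simps)
qed simp

lemma sat_cong: "(\<And>i. i \<in> free_vars \<phi> \<Longrightarrow> e i = e' i) \<Longrightarrow> sat M e \<phi> = sat M e' \<phi>"
proof (induction \<phi> arbitrary: e e')
  case (Equal s t)
  then show ?case by (simp add: tm_val_cong[of s e e'] tm_val_cong[of t e e'])
next
  case (Rel R ts)
  then have "map (tm_val M e) ts = map (tm_val M e') ts"
    by (intro map_cong refl tm_val_cong) auto
  then show ?case by (simp only: sat.simps)
next
  case (Exist i \<phi>)
  have "sat M (e(i := a)) \<phi> = sat M (e'(i := a)) \<phi>" for a
    using Exist.prems by (intro Exist.IH) auto
  then show ?case by simp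
next
  case (Neg \<phi>)
  then show ?case by (metis free_vars.simps(3) sat.simps(3))
next
  case (Conj \<phi> \<psi>)
  then show ?case by (metis UnCI free_vars.simps(4) sat.simps(4))
qed

fun rename_tm :: "(nat \<Rightarrow> nat) \<Rightarrow> 'f tm \<Rightarrow> 'f tm" where
  "rename_tm \<rho> (Var i) = Var (\<rho> i)"
| "rename_tm \<rho> (App h ts) = App h (map (rename_tm \<rho>) ts)"

lemma tm_in_rename_tm: "tm_in M t \<Longrightarrow> tm_in M (rename_tm \<rho> t)"
  by (induction t) auto

lemma tm_vars_rename_tm: "tm_vars (rename_tm \<rho> t) = \<rho> ` tm_vars t"
  by (induction t) auto

lemma tm_val_rename_tm: "tm_val M e (rename_tm \<rho> t) = tm_val M (\<lambda>i. e (\<rho> i)) t"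
proof (induction t)
  case (App h ts)
  then have "map (tm_val M e) (map (rename_tm \<rho>) ts) = map (tm_val M (\<lambda>i. e (\<rho> i))) ts"
    by simp
  then show ?case by (simp only: tm_val.simps rename_tm.simps)
qed simp

text \<open>
  The map \<open>\<rho>\<close> need not be injective, so renaming could identify a free variable with a bound
  one. The induction avoids capture by sending each bound variable to one that is fresh for the
  image of the free variables.
\<close>

lemma rename_fm:
  assumes "fm_in M \<phi>"
  shows "\<exists>\<psi>. fm_in M \<psi> \<and> free_vars \<psi> \<subseteq> \<rho> ` free_vars \<phi> \<and>
           (\<forall>e. sat M e \<psi> = sat M (\<lambda>i. e (\<rho> i)) \<phi>)"
  using assms
proof (induction \<phi> arbitrary: \<rho>)
  case (Equal s t)
  then show ?case
    by (intro exI[of _ "Equal (rename_tm \<rho> s) (rename_tm \<rho> t)"])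
       (auto simp: tm_in_rename_tm tm_vars_rename_tm tm_val_rename_tm)
next
  case (Rel R ts)
  have "map (tm_val M e) (map (rename_tm \<rho>) ts) = map (tm_val M (\<lambda>i. e (\<rho> i))) ts" for e
    by (simp add: tm_val_rename_tm)
  then have "sat M e (Rel R (map (rename_tm \<rho>) ts)) = sat M (\<lambda>i. e (\<rho> i)) (Rel R ts)" for e
    by (simp only: sat.simps)
  moreover have "fm_in M (Rel R (map (rename_tm \<rho>) ts))"
    using Rel by (simp add: tm_in_rename_tm)
  moreover have "free_vars (Rel R (map (rename_tm \<rho>) ts)) = \<rho> ` free_vars (Rel R ts)"
    by (simp add: tm_vars_rename_tm image_UN)
  ultimately show ?case by blast
next
  case (Neg \<phi>)
  then obtain \<psi> where "fm_in M \<psi>" "free_vars \<psi> \<subseteq> \<rho> ` free_vars \<phi>"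
      "\<forall>e. sat M e \<psi> = sat M (\<lambda>i. e (\<rho> i)) \<phi>"
    by (metis fm_in.simps(3))
  then show ?case by (intro exI[of _ "Neg \<psi>"]) auto
next
  case (Conj \<phi> \<phi>')
  obtain \<psi> where "fm_in M \<psi>" "free_vars \<psi> \<subseteq> \<rho> ` free_vars \<phi>"
      "\<forall>e. sat M e \<psi> = sat M (\<lambda>i. e (\<rho> i)) \<phi>"
    using Conj by (metis fm_in.simps(4))
  moreover obtain \<psi>' where "fm_in M \<psi>'" "free_vars \<psi>' \<subseteq> \<rho> ` free_vars \<phi>'"
      "\<forall>e. sat M e \<psi>' = sat M (\<lambda>i. e (\<rho> i)) \<phi>'"
    using Conj by (metis fm_in.simps(4))
  ultimately show ?case by (intro exI[of _ "Conj \<psi> \<psi>'"]) auto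
next
  case (Exist i \<phi>)
  obtain z where z: "z \<notin> \<rho> ` free_vars \<phi>"
    using ex_new_if_finite[OF infinite_UNIV_nat, of "\<rho> ` free_vars \<phi>"] finite_free_vars by blast
  obtain \<psi> where \<psi>: "fm_in M \<psi>" "free_vars \<psi> \<subseteq> (\<rho>(i := z)) ` free_vars \<phi>"
      "\<forall>e. sat M e \<psi> = sat M (\<lambda>j. e ((\<rho>(i := z)) j)) \<phi>"
    using Exist by (metis fm_in.simps(5))
  have "sat M (\<lambda>j. (e(z := a)) ((\<rho>(i := z)) j)) \<phi> = sat M ((\<lambda>j. e (\<rho> j))(i := a)) \<phi>" for e a
    using z by (intro sat_cong) auto
  with \<psi> show ?case
    by (intro exI[of _ "Exist z \<psi>"]) (auto split: if_splits)
qed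

text \<open>
  Definability is stated for predicates on assignments \<open>'i \<Rightarrow> 'a\<close> with an arbitrary index type
  \<open>'i\<close>, rather than for sets of lists. The map \<open>\<tau>\<close> interprets each formula variable either as
  one of the arguments or as a parameter from \<open>A\<close>. Substituting arguments or parameters then only
  changes \<open>\<tau>\<close>, and a quantified block of variables is a sum of index types, so that closure rules
  apply to ordinary HOL formulas by resolution. The index type may be infinite, but a formula
  sees only finitely many indices.
\<close>

definition definable_pred ::
    "('f, 'r, 'a) fo_structure \<Rightarrow> 'a set \<Rightarrow> (('i \<Rightarrow> 'a) \<Rightarrow> bool) \<Rightarrow> bool" where
  "definable_pred M A P \<longleftrightarrow>
     (\<exists>\<phi> \<tau>. fm_in M \<phi> \<and> range \<tau> \<subseteq> range Inl \<union> Inr ` A \<and>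
        (\<forall>e. P e \<longleftrightarrow> sat M (\<lambda>i. case \<tau> i of Inl j \<Rightarrow> e j | Inr c \<Rightarrow> c) \<phi>))"

lemma definable_pred_mono: "definable_pred M A P \<Longrightarrow> A \<subseteq> B \<Longrightarrow> definable_pred M B P"
  unfolding definable_pred_def by (meson image_mono subset_trans sup.mono order_refl)

lemma definable_pred_not:
  assumes "definable_pred M A P"
  shows "definable_pred M A (\<lambda>e. \<not> P e)"
proof -
  from assms obtain \<phi> \<tau> where "fm_in M \<phi>" "range \<tau> \<subseteq> range Inl \<union> Inr ` A"
      "\<forall>e. P e \<longleftrightarrow> sat M (\<lambda>i. case \<tau> i of Inl j \<Rightarrow> e j | Inr c \<Rightarrow> c) \<phi>"
    unfolding definable_pred_def by blast
  then show ?thesis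
    unfolding definable_pred_def by (intro exI[of _ "Neg \<phi>"] exI[of _ \<tau>]) simp
qed

lemma definable_pred_conj:
  assumes "definable_pred M A P" "definable_pred M A Q"
  shows "definable_pred M A (\<lambda>e. P e \<and> Q e)"
proof -
  from assms(1) obtain \<phi> \<tau> where 1: "fm_in M \<phi>" "range \<tau> \<subseteq> range Inl \<union> Inr ` A"
      "\<forall>e. P e \<longleftrightarrow> sat M (\<lambda>i. case \<tau> i of Inl j \<Rightarrow> e j | Inr c \<Rightarrow> c) \<phi>"
    unfolding definable_pred_def by blast
  from assms(2) obtain \<phi>' \<tau>' where 2: "fm_in M \<phi>'" "range \<tau>' \<subseteq> range Inl \<union> Inr ` A"
      "\<forall>e. Q e \<longleftrightarrow> sat M (\<lambda>i. case \<tau>' i of Inl j \<Rightarrow> e j | Inr c \<Rightarrow> c) \<phi>'"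
    unfolding definable_pred_def by blast
  (* Even and odd variables keep the two formulas apart, so that one map can interpret both. *)
  obtain \<psi> where \<psi>: "fm_in M \<psi>" "\<forall>e. sat M e \<psi> = sat M (\<lambda>i. e (2 * i)) \<phi>"
    using rename_fm[OF 1(1)] by metis
  obtain \<psi>' where \<psi>': "fm_in M \<psi>'" "\<forall>e. sat M e \<psi>' = sat M (\<lambda>i. e (Suc (2 * i))) \<phi>'"
    using rename_fm[OF 2(1)] by metis
  define \<tau>'' where "\<tau>'' i = (if even i then \<tau> (i div 2) else \<tau>' (i div 2))" for i
  have "\<tau>'' i \<in> range Inl \<union> Inr ` A" for i
    unfolding \<tau>''_def using 1(2) 2(2) by (cases "even i") (simp_all only: if_True if_False, blast+)
  then have "range \<tau>'' \<subseteq> range Inl \<union> Inr ` A" by blast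
  moreover have "\<tau>'' (2 * i) = \<tau> i" "\<tau>'' (Suc (2 * i)) = \<tau>' i" for i
    by (simp_all add: \<tau>''_def)
  ultimately show ?thesis
    unfolding definable_pred_def using 1 2 \<psi> \<psi>'
    by (intro exI[of _ "Conj \<psi> \<psi>'"] exI[of _ "\<tau>''"]) simp
qed

lemma definable_pred_disj:
  "definable_pred M A P \<Longrightarrow> definable_pred M A Q \<Longrightarrow> definable_pred M A (\<lambda>e. P e \<or> Q e)"
  using definable_pred_not[OF definable_pred_conj[OF definable_pred_not[of M A P] definable_pred_not[of M A Q]]]
  by simp

lemma definable_pred_imp:
  "definable_pred M A P \<Longrightarrow> definable_pred M A Q \<Longrightarrow> definable_pred M A (\<lambda>e. P e \<longrightarrow> Q e)"
  unfolding imp_conv_disj by (intro definable_pred_disj definable_pred_not)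

lemma definable_pred_const: "definable_pred M A (\<lambda>e. b)"
proof -
  have "definable_pred M A (\<lambda>e. True)"
    unfolding definable_pred_def
    by (intro exI[of _ "Exist 0 (Equal (Var 0) (Var 0))"] exI[of _ "\<lambda>_. Inl undefined"]) auto
  then show ?thesis
    using definable_pred_not[of M A "\<lambda>e. True"] by (cases b) auto
qed

lemma definable_pred_ball:
  assumes "finite S" "\<And>x. x \<in> S \<Longrightarrow> definable_pred M A (P x)"
  shows "definable_pred M A (\<lambda>e. \<forall>x\<in>S. P x e)"
  using assms by (induction S) (auto intro: definable_pred_const definable_pred_conj)

lemma definable_pred_bex:
  assumes "finite S" "\<And>x. x \<in> S \<Longrightarrow> definable_pred M A (P x)"
  shows "definable_pred M A (\<lambda>e. \<exists>x\<in>S. P x e)"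
  using assms by (induction S) (auto intro: definable_pred_const definable_pred_disj)

lemma definable_pred_eq: "definable_pred M A (\<lambda>e. e i = e j)"
  unfolding definable_pred_def
  by (intro exI[of _ "Equal (Var 0) (Var 1)"] exI[of _ "\<lambda>k. if k = 0 then Inl i else Inl j"]) auto

lemma definable_pred_reindex:
  fixes P :: "('i \<Rightarrow> 'a) \<Rightarrow> bool" and \<rho> :: "'i \<Rightarrow> 'j"
  assumes "definable_pred M A P"
  shows "definable_pred M A (\<lambda>e. P (\<lambda>j. e (\<rho> j)))"
proof -
  from assms obtain \<phi> \<tau> where *: "fm_in M \<phi>" "range \<tau> \<subseteq> range Inl \<union> Inr ` A"
      "\<forall>e. P e \<longleftrightarrow> sat M (\<lambda>i. case \<tau> i of Inl j \<Rightarrow> e j | Inr c \<Rightarrow> c) \<phi>"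
    unfolding definable_pred_def by blast
  have "(case map_sum \<rho> id t of Inl j \<Rightarrow> e j | Inr c \<Rightarrow> c) =
        (case t of Inl j \<Rightarrow> e (\<rho> j) | Inr c \<Rightarrow> c)" for t and e :: "'j \<Rightarrow> 'a"
    by (cases t) auto
  moreover have "map_sum \<rho> id t \<in> range Inl \<union> Inr ` A" if "t \<in> range Inl \<union> Inr ` A" for t
    using that by auto
  then have "range (\<lambda>i. map_sum \<rho> id (\<tau> i)) \<subseteq> range Inl \<union> Inr ` A"
    using *(2) by blast
  ultimately show ?thesis
    unfolding definable_pred_def using *
    by (intro exI[of _ \<phi>] exI[of _ "\<lambda>i. map_sum \<rho> id (\<tau> i)"]) simp
qed

lemma definable_pred_param:
  fixes P :: "('i option \<Rightarrow> 'a) \<Rightarrow> bool"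
  assumes "definable_pred M A P" and "c \<in> A"
  shows "definable_pred M A (\<lambda>e. P (case_option c e))"
proof -
  from assms obtain \<phi> \<tau> where *: "fm_in M \<phi>" "range \<tau> \<subseteq> range Inl \<union> Inr ` A"
      "\<forall>e. P e \<longleftrightarrow> sat M (\<lambda>i. case \<tau> i of Inl j \<Rightarrow> e j | Inr c \<Rightarrow> c) \<phi>"
    unfolding definable_pred_def by blast
  define g where "g t = (case t of Inl None \<Rightarrow> Inr c | Inl (Some j) \<Rightarrow> Inl j | Inr d \<Rightarrow> Inr d)"
    for t :: "'i option + 'a"
  have "(case g t of Inl j \<Rightarrow> e j | Inr c \<Rightarrow> c) =
        (case t of Inl j \<Rightarrow> case_option c e j | Inr c \<Rightarrow> c)" for t e
    by (auto simp: g_def split: sum.splits option.splits)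
  moreover have "g t \<in> range Inl \<union> Inr ` A" if "t \<in> range Inl \<union> Inr ` A" for t
    using that assms(2) by (auto simp: g_def split: option.splits)
  then have "range (\<lambda>i. g (\<tau> i)) \<subseteq> range Inl \<union> Inr ` A"
    using *(2) by blast
  ultimately show ?thesis
    using * unfolding definable_pred_def
    by (intro exI[of _ \<phi>] exI[of _ "\<lambda>i. g (\<tau> i)"]) simp
qed

lemma definable_pred_eq_const: "c \<in> A \<Longrightarrow> definable_pred M A (\<lambda>e. e i = c)"
  using definable_pred_param[OF definable_pred_eq[of M A "Some i" None]] by simp

text \<open>
  Turns a parameter back into an argument: a set definable over \<open>insert c A\<close> is the fibre above
  \<open>c\<close> of a relation definable over \<open>A\<close>. This is how the single element \<open>g\<close> in
  \<open>acl M (F \<union> {g})\<close> becomes a variable.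
\<close>

lemma definable_pred_abstract_param:
  fixes P :: "('i \<Rightarrow> 'a) \<Rightarrow> bool"
  assumes "definable_pred M (insert c A) P"
  obtains Q where "definable_pred M A (\<lambda>e. Q (e None) (\<lambda>j. e (Some j)))" "\<And>e. P e = Q c e"
proof -
  from assms obtain \<phi> \<tau> where *: "fm_in M \<phi>" "range \<tau> \<subseteq> range Inl \<union> Inr ` insert c A"
      "\<forall>e. P e \<longleftrightarrow> sat M (\<lambda>i. case \<tau> i of Inl j \<Rightarrow> e j | Inr c \<Rightarrow> c) \<phi>"
    unfolding definable_pred_def by blast
  define g where "g t = (if t = Inr c then Inl None else map_sum Some id t)" for t :: "'i + 'a"
  define Q where
    "Q x e = sat M (\<lambda>i. case g (\<tau> i) of Inl j \<Rightarrow> case_option x e j | Inr d \<Rightarrow> d) \<phi>" for x e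
  have eta: "case_option (e None) (\<lambda>j. e (Some j)) j = e j" for e :: "'i option \<Rightarrow> 'a" and j
    by (cases j) auto
  show ?thesis
  proof
    have "g t \<in> range Inl \<union> Inr ` A" if "t \<in> range Inl \<union> Inr ` insert c A" for t
      using that by (auto simp: g_def)
    then have "range (\<lambda>i. g (\<tau> i)) \<subseteq> range Inl \<union> Inr ` A"
      using *(2) by blast
    then show "definable_pred M A (\<lambda>e. Q (e None) (\<lambda>j. e (Some j)))"
      unfolding definable_pred_def Q_def eta using *(1)
      by (intro exI[of _ \<phi>] exI[of _ "\<lambda>i. g (\<tau> i)"]) simp
    have "(case g t of Inl j \<Rightarrow> case_option c e j | Inr d \<Rightarrow> d) =
        (case t of Inl j \<Rightarrow> e j | Inr d \<Rightarrow> d)" for t e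
      by (cases t) (auto simp: g_def)
    then show "P e = Q c e" for e
      using *(3) by (simp add: Q_def)
  qed
qed

lemma definable_pred_finite_support:
  assumes "definable_pred M A P"
  obtains V where "finite V" "\<And>e e'. (\<And>j. j \<in> V \<Longrightarrow> e j = e' j) \<Longrightarrow> P e = P e'"
proof -
  from assms obtain \<phi> \<tau> where *: "fm_in M \<phi>"
      "\<forall>e. P e \<longleftrightarrow> sat M (\<lambda>i. case \<tau> i of Inl j \<Rightarrow> e j | Inr c \<Rightarrow> c) \<phi>"
    unfolding definable_pred_def by blast
  define V where "V = {j. \<exists>i\<in>free_vars \<phi>. \<tau> i = Inl j}"
  show ?thesis
  proof
    show "finite V"
      by (rule finite_subset[of _ "Inl -` (\<tau> ` free_vars \<phi>)"])
         (auto simp: V_def image_iff finite_free_vars intro!: finite_vimageI intro: sym)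
    show "P e = P e'" if "\<And>j. j \<in> V \<Longrightarrow> e j = e' j" for e e'
      unfolding *(2)[rule_format]
      by (intro sat_cong) (auto split: sum.splits intro!: that simp: V_def)
  qed
qed

lemma definable_pred_ex_upd:
  assumes "definable_pred M A P"
  shows "definable_pred M A (\<lambda>e. \<exists>a. P (e(x := a)))"
proof -
  from assms obtain \<phi> \<tau> where *: "fm_in M \<phi>" "range \<tau> \<subseteq> range Inl \<union> Inr ` A"
      "\<forall>e. P e \<longleftrightarrow> sat M (\<lambda>i. case \<tau> i of Inl j \<Rightarrow> e j | Inr c \<Rightarrow> c) \<phi>"
    unfolding definable_pred_def by blast
  (* All formula variables that stand for the index x are merged into variable 0, which is
     then quantified. *)
  define \<rho> where "\<rho> i = (if \<tau> i = Inl x then 0 else Suc i)" for i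
  define \<tau>' where "\<tau>' i = (case i of 0 \<Rightarrow> Inl x | Suc k \<Rightarrow> \<tau> k)" for i
  obtain \<psi> where \<psi>: "fm_in M \<psi>" "\<forall>e. sat M e \<psi> = sat M (\<lambda>i. e (\<rho> i)) \<phi>"
    using rename_fm[OF *(1)] by metis
  have "((\<lambda>i. case \<tau>' i of Inl j \<Rightarrow> e j | Inr c \<Rightarrow> c)(0 := a)) (\<rho> i) =
      (case \<tau> i of Inl j \<Rightarrow> (e(x := a)) j | Inr c \<Rightarrow> c)" for e a i
    by (auto simp: \<rho>_def \<tau>'_def split: sum.splits)
  moreover have "\<tau>' i \<in> range Inl \<union> Inr ` A" for i
    unfolding \<tau>'_def using *(2) by (cases i) (simp, simp only: nat.case, blast)
  then have "range \<tau>' \<subseteq> range Inl \<union> Inr ` A"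
    by blast
  ultimately show ?thesis
    unfolding definable_pred_def using * \<psi>
    by (intro exI[of _ "Exist 0 \<psi>"] exI[of _ \<tau>']) simp
qed

lemma definable_pred_ex_override_finite:
  assumes "definable_pred M A P" "finite V"
  shows "definable_pred M A (\<lambda>e. \<exists>v. P (override_on e v V))"
  using assms(2)
proof induction
  case (insert x V)
  have "(\<exists>v. P (override_on e v (insert x V))) \<longleftrightarrow> (\<exists>a v. P (override_on (e(x := a)) v V))" for e
  proof
    assume "\<exists>v. P (override_on e v (insert x V))"
    then obtain v where v: "P (override_on e v (insert x V))" ..
    have "override_on e v (insert x V) = override_on (e(x := v x)) v V"
      by (auto simp: override_on_def)
    with v show "\<exists>a v. P (override_on (e(x := a)) v V)" by metis
  next
    assume "\<exists>a v. P (override_on (e(x := a)) v V)"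
    then obtain a v where v: "P (override_on (e(x := a)) v V)" by blast
    have "override_on (e(x := a)) v V = override_on e (v(x := a)) (insert x V)"
      using insert(2) by (auto simp: override_on_def)
    with v show "\<exists>v. P (override_on e v (insert x V))" by metis
  qed
  then show ?case using definable_pred_ex_upd[OF insert(3), of x] by (simp only:)
qed (use assms(1) in simp)

text \<open>
  Quantifies over a whole assignment \<open>v :: 'j \<Rightarrow> 'a\<close> at once, even for infinite \<open>'j\<close>: only
  finitely many values of \<open>v\<close> matter to a formula, so this is a finite block of quantifiers.
  Tuples of varying length can thus be quantified as functions on the natural numbers.
\<close>

lemma definable_pred_ex:
  fixes Q :: "('i \<Rightarrow> 'a) \<Rightarrow> ('j \<Rightarrow> 'a) \<Rightarrow> bool"
  assumes "definable_pred M A (\<lambda>e. Q (\<lambda>i. e (Inl i)) (\<lambda>j. e (Inr j)))"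
  shows "definable_pred M A (\<lambda>e. \<exists>v. Q e v)"
proof -
  let ?P = "\<lambda>e. Q (\<lambda>i. e (Inl i)) (\<lambda>j. e (Inr j))"
  obtain V where V: "finite V" "\<And>e e'. (\<And>j. j \<in> V \<Longrightarrow> e j = e' j) \<Longrightarrow> ?P e = ?P e'"
    using definable_pred_finite_support[OF assms] by blast
  have "(\<exists>v. Q e v) \<longleftrightarrow> (\<exists>w. ?P (override_on (case_sum e d) w (V \<inter> range Inr)))" for e d
  proof
    assume "\<exists>v. Q e v"
    then obtain v where "?P (case_sum e v)" by auto
    moreover have "?P (case_sum e v) = ?P (override_on (case_sum e d) (case_sum e v) (V \<inter> range Inr))"
      by (rule V(2)) (auto simp: override_on_def split: sum.splits)
    ultimately show "\<exists>w. ?P (override_on (case_sum e d) w (V \<inter> range Inr))" by blast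
  next
    assume "\<exists>w. ?P (override_on (case_sum e d) w (V \<inter> range Inr))"
    then obtain w where w: "?P (override_on (case_sum e d) w (V \<inter> range Inr))" ..
    have "(\<lambda>i. override_on (case_sum e d) w (V \<inter> range Inr) (Inl i)) = e"
      by (auto simp: override_on_def)
    with w show "\<exists>v. Q e v" by auto
  qed
  note eq = this
  (* The values at the Inr indices that occur are overwritten by the quantifier, so an
     arbitrary index may be read there. *)
  let ?c = "\<lambda>e j. e (case_sum id (\<lambda>_. undefined) j)"
  have c: "?c e = case_sum e (\<lambda>_. e undefined)" for e :: "'i \<Rightarrow> 'a"
    by (auto split: sum.splits)
  have "definable_pred M A (\<lambda>e. \<exists>w. ?P (override_on e w (V \<inter> range Inr)))"
    by (rule definable_pred_ex_override_finite[OF assms]) (use V in auto)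
  from definable_pred_reindex[OF this, of "case_sum id (\<lambda>_. undefined)"]
  have "definable_pred M A (\<lambda>e. \<exists>w. ?P (override_on (?c e) w (V \<inter> range Inr)))" .
  moreover have "(\<lambda>e. \<exists>v. Q e v) = (\<lambda>e. \<exists>w. ?P (override_on (?c e) w (V \<inter> range Inr)))"
    unfolding c by (intro ext eq)
  ultimately show ?thesis by (simp only:)
qed

lemma definable_pred_all:
  assumes "definable_pred M A (\<lambda>e. Q (\<lambda>i. e (Inl i)) (\<lambda>j. e (Inr j)))"
  shows "definable_pred M A (\<lambda>e. \<forall>v. Q e v)"
  using definable_pred_not[OF definable_pred_ex[of M A "\<lambda>e v. \<not> Q e v"]]
    definable_pred_not[OF assms] by simp

section \<open>Definable sets, expansions and saturation\<close>

lemma definable_pred_finite_params: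
  fixes P :: "('i \<Rightarrow> 'a) \<Rightarrow> bool"
  assumes "definable_pred M A P"
  obtains C where "finite C" "C \<subseteq> A" "definable_pred M C P"
proof -
  from assms obtain \<phi> \<tau> where *: "fm_in M \<phi>" "range \<tau> \<subseteq> range Inl \<union> Inr ` A"
      "\<forall>e. P e \<longleftrightarrow> sat M (\<lambda>i. case \<tau> i of Inl j \<Rightarrow> e j | Inr c \<Rightarrow> c) \<phi>"
    unfolding definable_pred_def by blast
  define C where "C = {c. \<exists>i\<in>free_vars \<phi>. \<tau> i = Inr c}"
  define \<tau>' where "\<tau>' i = (if i \<in> free_vars \<phi> then \<tau> i else Inl undefined)" for i
  have "finite C"
    by (rule finite_subset[of _ "projr ` \<tau> ` free_vars \<phi>"]) (force simp: C_def finite_free_vars)+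
  moreover have "C \<subseteq> A"
  proof
    fix c assume "c \<in> C"
    then obtain i where i: "\<tau> i = Inr c" by (auto simp: C_def)
    have "\<tau> i \<in> range Inl \<union> Inr ` A" using *(2) by blast
    then show "c \<in> A" unfolding i by auto
  qed
  moreover have "definable_pred M C P"
  proof -
    have "\<tau>' i \<in> range Inl \<union> Inr ` C" for i
      by (cases "\<tau> i") (auto simp: \<tau>'_def C_def)
    then have "range \<tau>' \<subseteq> range Inl \<union> Inr ` C" by blast
    moreover have "P e \<longleftrightarrow> sat M (\<lambda>i. case \<tau>' i of Inl j \<Rightarrow> e j | Inr c \<Rightarrow> c) \<phi>" for e
      unfolding *(3)[rule_format] by (rule sat_cong) (simp add: \<tau>'_def)
    ultimately show ?thesis
      unfolding definable_pred_def using *(1) by blast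
  qed
  ultimately show ?thesis by (rule that)
qed

lemma definable_pred_list_form:
  fixes M :: "('f, 'r, 'a) fo_structure"
  assumes "definable_pred M (set cs) (\<lambda>e. Q (map e [0..<k]))" and "k > 0"
  shows "\<exists>\<psi>. fm_in M \<psi> \<and> free_vars \<psi> \<subseteq> {..<k + length cs} \<and>
           (\<forall>xs. length xs = k \<longrightarrow> (Q xs \<longleftrightarrow> sat M ((!) (xs @ cs)) \<psi>))"
proof -
  from assms(1) obtain \<phi> \<tau> where *: "fm_in M \<phi>" "range \<tau> \<subseteq> range Inl \<union> Inr ` set cs"
      "\<forall>e. Q (map e [0..<k]) \<longleftrightarrow> sat M (\<lambda>i. case \<tau> i of Inl j \<Rightarrow> e j | Inr c \<Rightarrow> c) \<phi>"
    unfolding definable_pred_def by blast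
  have "\<forall>c\<in>set cs. \<exists>i. i < length cs \<and> cs ! i = c"
    by (simp add: in_set_conv_nth)
  then obtain idx where idx: "\<And>c. c \<in> set cs \<Longrightarrow> idx c < length cs \<and> cs ! idx c = c"
    by metis
  (* The predicate depends on the first k arguments only, so all other indices can be
     redirected to 0; this is one of the first k because k > 0. *)
  define \<rho> where
    "\<rho> i = (case \<tau> i of Inl j \<Rightarrow> (if j < k then j else 0) | Inr c \<Rightarrow> k + idx c)" for i
  obtain \<psi> where \<psi>: "fm_in M \<psi>" "free_vars \<psi> \<subseteq> \<rho> ` free_vars \<phi>"
      "\<And>e. sat M e \<psi> = sat M (\<lambda>i. e (\<rho> i)) \<phi>"
    using rename_fm[OF *(1), of \<rho>] by blast
  have range: "(\<exists>j. \<tau> i = Inl j) \<or> (\<exists>c\<in>set cs. \<tau> i = Inr c)" for i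
    using subsetD[OF *(2), of "\<tau> i"] by blast
  have "\<rho> i < k + length cs" for i
    using range[of i] idx \<open>k > 0\<close> by (auto simp: \<rho>_def)
  then have "free_vars \<psi> \<subseteq> {..<k + length cs}"
    using \<psi>(2) by auto
  moreover have "Q xs \<longleftrightarrow> sat M ((!) (xs @ cs)) \<psi>" if xs: "length xs = k" for xs
  proof -
    define e where "e j = xs ! (if j < k then j else 0)" for j
    have "map e [0..<k] = xs"
      using xs by (intro nth_equalityI) (auto simp: e_def)
    then have "Q xs \<longleftrightarrow> sat M (\<lambda>i. case \<tau> i of Inl j \<Rightarrow> e j | Inr c \<Rightarrow> c) \<phi>"
      using *(3) by metis
    also have "\<dots> \<longleftrightarrow> sat M (\<lambda>i. (xs @ cs) ! \<rho> i) \<phi>"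
    proof (rule sat_cong)
      fix i
      show "(case \<tau> i of Inl j \<Rightarrow> e j | Inr c \<Rightarrow> c) = (xs @ cs) ! \<rho> i"
        using range[of i] idx xs \<open>k > 0\<close> by (auto simp: \<rho>_def e_def nth_append)
    qed
    finally show ?thesis using \<psi>(3) by simp
  qed
  ultimately show ?thesis using \<psi>(1) by blast
qed

lemma definable_over_imp_definable_pred:
  assumes "definable_over M A k X"
  shows "definable_pred M A (\<lambda>e. map e [0..<k] \<in> X)"
proof -
  from assms obtain \<phi> cs where *: "fm_in M \<phi>" "set cs \<subseteq> A" "free_vars \<phi> \<subseteq> {..<k + length cs}"
      "X = {xs. length xs = k \<and> sat M ((!) (xs @ cs)) \<phi>}"
    unfolding definable_over_def by blast
  define \<tau> where
    "\<tau> i = (if i < k then Inl i else if i < k + length cs then Inr (cs ! (i - k)) else Inl i)" for i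
  have "cs ! (i - k) \<in> A" if "\<not> i < k" "i < k + length cs" for i
    using that by (intro subsetD[OF *(2)] nth_mem) simp
  then have "\<tau> i \<in> range Inl \<union> Inr ` A" for i
    by (simp add: \<tau>_def)
  then have "range \<tau> \<subseteq> range Inl \<union> Inr ` A" by blast
  moreover have "map e [0..<k] \<in> X \<longleftrightarrow> sat M (\<lambda>i. case \<tau> i of Inl j \<Rightarrow> e j | Inr c \<Rightarrow> c) \<phi>" for e
  proof -
    have "map e [0..<k] \<in> X \<longleftrightarrow> sat M ((!) (map e [0..<k] @ cs)) \<phi>"
      using *(4) by simp
    also have "\<dots> \<longleftrightarrow> sat M (\<lambda>i. case \<tau> i of Inl j \<Rightarrow> e j | Inr c \<Rightarrow> c) \<phi>"
      using *(3) by (intro sat_cong) (auto simp: \<tau>_def nth_append)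
    finally show ?thesis .
  qed
  ultimately show ?thesis
    unfolding definable_pred_def using *(1) by blast
qed

lemma definable_pred_imp_definable_over:
  assumes "definable_pred M A (\<lambda>e. map e [0..<k] \<in> X)" "k > 0"
    and X: "\<And>xs. xs \<in> X \<Longrightarrow> length xs = k"
  shows "definable_over M A k X"
proof -
  obtain C where C: "finite C" "C \<subseteq> A" "definable_pred M C (\<lambda>e. map e [0..<k] \<in> X)"
    using definable_pred_finite_params[OF assms(1)] by blast
  obtain cs where cs: "set cs = C" using finite_list[OF C(1)] by blast
  obtain \<psi> where \<psi>: "fm_in M \<psi>" "free_vars \<psi> \<subseteq> {..<k + length cs}"
      "\<forall>xs. length xs = k \<longrightarrow> (xs \<in> X \<longleftrightarrow> sat M ((!) (xs @ cs)) \<psi>)"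
    using definable_pred_list_form[of M cs "\<lambda>xs. xs \<in> X" k] C(3) cs \<open>k > 0\<close> by blast
  have "X = {xs. length xs = k \<and> sat M ((!) (xs @ cs)) \<psi>}"
    using \<psi>(3) X by blast
  then show ?thesis
    unfolding definable_over_def using \<psi>(1,2) cs C(2) by blast
qed

text \<open>
  The expansion hypothesis concerns sets that are definable without parameters, so the parameters
  of \<open>P\<close> have to be treated as further arguments: the formula itself, read as a relation between
  all its free variables, is transferred.
\<close>

lemma definable_pred_zero_expansion:
  assumes "is_zero_expansion N M" "definable_pred M A P"
  shows "definable_pred N A P"
proof -
  from assms(2) obtain \<phi> \<tau> where *: "fm_in M \<phi>" "range \<tau> \<subseteq> range Inl \<union> Inr ` A"
      "\<forall>e. P e \<longleftrightarrow> sat M (\<lambda>i. case \<tau> i of Inl j \<Rightarrow> e j | Inr c \<Rightarrow> c) \<phi>"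
    unfolding definable_pred_def by blast
  obtain k where k: "free_vars \<phi> \<subseteq> {..<k}"
    using finite_nat_iff_bounded finite_free_vars by blast
  define X where "X = {xs. length xs = k \<and> sat M ((!) xs) \<phi>}"
  have "definable_over M {} k X"
    unfolding definable_over_def X_def using *(1) k
    by (intro exI[of _ \<phi>] exI[of _ "[]"]) simp
  then have "definable_over N {} k X"
    using assms(1) unfolding is_expansion_over_def by blast
  then obtain \<psi> where \<psi>: "fm_in N \<psi>" "free_vars \<psi> \<subseteq> {..<k}"
      "X = {xs. length xs = k \<and> sat N ((!) xs) \<psi>}"
    unfolding definable_over_def by auto
  have "sat M e \<phi> \<longleftrightarrow> sat N e \<psi>" for e
  proof -
    have "sat M e \<phi> \<longleftrightarrow> sat M ((!) (map e [0..<k])) \<phi>"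
      using k by (intro sat_cong) auto
    also have "\<dots> \<longleftrightarrow> map e [0..<k] \<in> X" by (simp add: X_def)
    also have "\<dots> \<longleftrightarrow> sat N ((!) (map e [0..<k])) \<psi>" unfolding \<psi>(3) by simp
    also have "\<dots> \<longleftrightarrow> sat N e \<psi>"
      using \<psi>(2) by (intro sat_cong) auto
    finally show ?thesis .
  qed
  with * \<psi>(1) show ?thesis
    unfolding definable_pred_def by (intro exI[of _ \<psi>] exI[of _ \<tau>]) simp
qed

abbreviation definable_rel ::
    "('f, 'r, 'a) fo_structure \<Rightarrow> 'a set \<Rightarrow> ('a \<Rightarrow> 'a \<Rightarrow> bool) \<Rightarrow> bool" where
  "definable_rel M A R \<equiv> definable_pred M A (\<lambda>e :: nat \<Rightarrow> 'a. R (e 0) (e 1))"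

lemma definable_rel_reindex:
  assumes "definable_rel M A R"
  shows "definable_pred M A (\<lambda>e. R (e i) (e j))"
  using definable_pred_reindex[OF assms, of "\<lambda>n. if n = 0 then i else j"] by simp

abbreviation definable_add :: "('f, 'r, 'a::ab_group_add) fo_structure \<Rightarrow> 'a set \<Rightarrow> bool" where
  "definable_add M A \<equiv> definable_pred M A (\<lambda>e :: nat \<Rightarrow> 'a. e 0 + e 1 = e 2)"

lemma definable_add_reindex:
  assumes "definable_add M A"
  shows "definable_pred M A (\<lambda>e. e i + e j = e k)"
  using definable_pred_reindex[OF assms, of "\<lambda>n. if n = 0 then i else if n = 1 then j else k"]
  by simp

lemma map_upt_2: "map e [0..<2] = [e 0, e 1]"
  by (simp add: upt_rec)

lemma definable_map_iff: "definable_map M f \<longleftrightarrow> definable_rel M UNIV (\<lambda>x y. y = f x)"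
proof -
  let ?X = "{[x, f x] |x. True}"
  have *: "(\<lambda>e. map e [0..<2] \<in> ?X) = (\<lambda>e. e 1 = f (e 0))"
    by (auto simp: map_upt_2)
  show ?thesis
  proof
    assume "definable_map M f"
    then have "definable_pred M UNIV (\<lambda>e. map e [0..<2] \<in> ?X)"
      unfolding definable_map_def by (rule definable_over_imp_definable_pred)
    then show "definable_rel M UNIV (\<lambda>x y. y = f x)" unfolding * .
  next
    assume "definable_rel M UNIV (\<lambda>x y. y = f x)"
    then have "definable_pred M UNIV (\<lambda>e. map e [0..<2] \<in> ?X)" unfolding * .
    then show "definable_map M f"
      unfolding definable_map_def by (rule definable_pred_imp_definable_over) auto
  qed
qed

lemma definable_add_expansion:
  fixes M :: "('g, 's, 'a::ab_group_add) fo_structure"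
  assumes "is_expansion M (group_structure :: (unit, unit, 'a) fo_structure)"
  shows "definable_add M UNIV"
proof -
  define X :: "'a list set" where "X = {xs. length xs = 3 \<and> xs ! 0 + xs ! 1 = xs ! 2}"
  have "definable_over (group_structure :: (unit, unit, 'a) fo_structure) {} 3 X"
    unfolding definable_over_def X_def
    by (intro exI[of _ "Equal (App () [Var 0, Var 1]) (Var 2)"] exI[of _ "[]"])
       (auto simp: group_structure_def)
  then have "definable_over M UNIV 3 X"
    using assms unfolding is_expansion_over_def by blast
  from definable_over_imp_definable_pred[OF this] show ?thesis
    by (simp add: X_def numeral_2_eq_2)
qed

text \<open>
  Saturation in semantic form: over a fixed finite parameter set, definable properties of a single
  element that are finitely satisfiable have a common witness.
\<close>

lemma saturated_realizes:
  fixes N :: "('f, 'r, 'a) fo_structure" and \<P> :: "('a \<Rightarrow> bool) set"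
  assumes "omega_saturated N" "finite C"
    and def: "\<And>P. P \<in> \<P> \<Longrightarrow> definable_pred N C (\<lambda>e :: nat \<Rightarrow> 'a. P (e 0))"
    and fin: "\<And>\<Q>. \<Q> \<subseteq> \<P> \<Longrightarrow> finite \<Q> \<Longrightarrow> \<exists>a. \<forall>P\<in>\<Q>. P a"
  shows "\<exists>a. \<forall>P\<in>\<P>. P a"
proof -
  obtain cs where cs: "set cs = C" using finite_list[OF assms(2)] by blast
  have "\<exists>\<psi>. fm_in N \<psi> \<and> free_vars \<psi> \<subseteq> {..<Suc (length cs)} \<and> (\<forall>a. P a \<longleftrightarrow> sat N ((!) (a # cs)) \<psi>)"
    if "P \<in> \<P>" for P
  proof -
    have "definable_pred N (set cs) (\<lambda>e. (\<lambda>xs. P (xs ! 0)) (map e [0..<1]))"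
      using def[OF that] cs by simp
    from definable_pred_list_form[OF this] obtain \<psi> where
      "fm_in N \<psi>" "free_vars \<psi> \<subseteq> {..<1 + length cs}"
      "\<And>xs. length xs = 1 \<Longrightarrow> (P (xs ! 0) \<longleftrightarrow> sat N ((!) (xs @ cs)) \<psi>)" by auto
    from this(1,2) this(3)[of "[a]" for a] show ?thesis by auto
  qed
  then obtain \<psi> where \<psi>: "\<And>P. P \<in> \<P> \<Longrightarrow> fm_in N (\<psi> P)"
    "\<And>P. P \<in> \<P> \<Longrightarrow> free_vars (\<psi> P) \<subseteq> {..<Suc (length cs)}"
    "\<And>P a. P \<in> \<P> \<Longrightarrow> P a \<longleftrightarrow> sat N ((!) (a # cs)) (\<psi> P)"
    by metis
  have "\<exists>a. \<forall>\<phi>\<in>q. sat N ((!) (a # cs)) \<phi>" if q: "q \<subseteq> \<psi> ` \<P>" "finite q" for q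
  proof -
    obtain \<Q> where "\<Q> \<subseteq> \<P>" "finite \<Q>" "q = \<psi> ` \<Q>"
      using finite_subset_image[OF q(2,1)] by blast
    moreover from this obtain a where "\<forall>P\<in>\<Q>. P a" using fin by blast
    ultimately have "\<forall>\<phi>\<in>q. sat N ((!) (a # cs)) \<phi>" using \<psi>(3) by auto
    then show ?thesis ..
  qed
  moreover have "\<forall>\<phi>\<in>\<psi> ` \<P>. fm_in N \<phi> \<and> free_vars \<phi> \<subseteq> {..<Suc (length cs)}"
    using \<psi>(1,2) by simp
  ultimately obtain a where "\<forall>\<phi>\<in>\<psi> ` \<P>. sat N ((!) (a # cs)) \<phi>"
    using assms(1) unfolding omega_saturated_def by metis
  then have "\<forall>P\<in>\<P>. P a" using \<psi>(3) by simp
  then show ?thesis ..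
qed

section \<open>Homomorphisms through a relation with bounded fibres\<close>

text \<open>
  A quantitative form of B. H. Neumann's covering lemma: an abelian group is not a union of \<open>n\<close>
  subgroups (here, kernels) that all have index greater than \<open>n\<close>. For each \<open>i\<close> choose \<open>n + 1\<close>
  elements \<open>y i c\<close> in distinct cosets of the \<open>i\<close>-th subgroup and look at the \<open>(n + 1)^n\<close> sums
  \<open>\<Sum>i. y i (c i)\<close>. If all entries of \<open>c\<close> but the \<open>i\<close>-th are fixed, at most one choice of
  \<open>c i\<close> puts the sum into the \<open>i\<close>-th subgroup, so that subgroup accounts for at most
  \<open>(n + 1)^(n - 1)\<close> choices, and all of them together for at most \<open>n * (n + 1)^(n - 1)\<close>.
\<close>

lemma ex_nonzero_of_large_ranges:
  fixes d :: "'i \<Rightarrow> 'a::ab_group_add \<Rightarrow> 'b::ab_group_add"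
  assumes "finite I" and additive: "\<And>i. i \<in> I \<Longrightarrow> additive (d i)"
    and large: "\<And>i. i \<in> I \<Longrightarrow> finite (range (d i)) \<Longrightarrow> card I < card (range (d i))"
  shows "\<exists>x. \<forall>i\<in>I. d i x \<noteq> 0"
proof (cases "I = {}")
  case False
  define n where "n = card I"
  have "\<exists>y. inj_on (\<lambda>c. d i (y c)) {..n}" if "i \<in> I" for i
  proof -
    have "\<exists>T. T \<subseteq> range (d i) \<and> finite T \<and> card T = Suc n"
    proof (cases "finite (range (d i))")
      case True
      then have "Suc n \<le> card (range (d i))" using large[OF that] by (simp add: n_def)
      then show ?thesis using obtain_subset_with_card_n by metis
    next
      case False
      then show ?thesis using infinite_arbitrarily_large by blast
    qed
    then obtain T where T: "T \<subseteq> range (d i)" "finite T" "card T = Suc n"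
      by blast
    then obtain b where b: "bij_betw b {0..<Suc n} T"
      using ex_bij_betw_nat_finite by metis
    have "inj_on (\<lambda>c. d i (inv (d i) (b c))) {..n}"
    proof (subst inj_on_cong[where g = b])
      show "d i (inv (d i) (b c)) = b c" if "c \<in> {..n}" for c
        using that T(1) b by (intro f_inv_into_f) (auto simp: bij_betw_def)
      show "inj_on b {..n}"
        using b by (simp add: bij_betw_def atLeast0LessThan lessThan_Suc_atMost)
    qed
    then show ?thesis by (rule exI[of _ "\<lambda>c. inv (d i) (b c)"])
  qed
  then obtain y where y: "\<And>i. i \<in> I \<Longrightarrow> inj_on (\<lambda>c. d i (y i c)) {..n}"
    by metis
  define C where "C = (\<Pi>\<^sub>E i\<in>I. {..n})"
  define s where "s c = (\<Sum>i\<in>I. y i (c i))" for c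
  define Z where "Z i = {c \<in> C. d i (s c) = 0}" for i
  have finC: "finite C" and cardC: "card C = Suc n ^ n"
    by (simp_all add: C_def \<open>finite I\<close> finite_PiE card_PiE n_def)
  have cardZ: "card (Z i) \<le> Suc n ^ (n - 1)" if i: "i \<in> I" for i
  proof -
    let ?D = "\<Pi>\<^sub>E j\<in>I - {i}. {..n}"
    have ds: "d i (s c) = d i (y i (c i)) + d i (\<Sum>j\<in>I - {i}. y j (c j))" for c
      unfolding s_def using i \<open>finite I\<close> by (simp add: sum.remove additive.add[OF additive])
    have "inj_on (\<lambda>c. restrict c (I - {i})) (Z i)"
    proof (rule inj_onI)
      fix c c' assume c: "c \<in> Z i" "c' \<in> Z i" "restrict c (I - {i}) = restrict c' (I - {i})"
      then have off: "c j = c' j" if "j \<in> I - {i}" for j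
        using that by (metis restrict_apply')
      then have "(\<Sum>j\<in>I - {i}. y j (c j)) = (\<Sum>j\<in>I - {i}. y j (c' j))"
        by simp
      moreover have "d i (s c) = d i (s c')"
        using c(1,2) by (simp add: Z_def)
      ultimately have "d i (y i (c i)) = d i (y i (c' i))"
        unfolding ds by simp
      then have "c i = c' i"
        using inj_onD[OF y[OF i]] c(1,2) i by (auto simp: Z_def C_def PiE_iff)
      with off show "c = c'"
        using c(1,2) unfolding Z_def C_def by (intro PiE_ext[of c I "\<lambda>_. {..n}" c']) auto
    qed
    moreover have "restrict c (I - {i}) \<in> ?D" if "c \<in> Z i" for c
      unfolding restrict_PiE_iff using that PiE_mem[of c I "\<lambda>_. {..n}"] by (simp add: Z_def C_def)
    then have "(\<lambda>c. restrict c (I - {i})) ` Z i \<subseteq> ?D"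
      by blast
    moreover have "finite ?D" by (simp add: \<open>finite I\<close> finite_PiE)
    ultimately have "card (Z i) \<le> card ?D" by (rule card_inj_on_le)
    also have "card ?D = Suc n ^ (n - 1)"
      using i \<open>finite I\<close> by (simp add: card_PiE n_def)
    finally show ?thesis .
  qed
  have "card (\<Union>i\<in>I. Z i) \<le> (\<Sum>i\<in>I. card (Z i))"
    by (rule card_UN_le) fact
  also have "\<dots> \<le> (\<Sum>i\<in>I. Suc n ^ (n - 1))"
    by (rule sum_mono) (rule cardZ)
  also have "\<dots> = n * Suc n ^ (n - 1)"
    by (simp add: n_def)
  also have "\<dots> < Suc n * Suc n ^ (n - 1)"
    by simp
  also have "\<dots> = card C"
    using False \<open>finite I\<close> unfolding cardC by (cases n) (simp_all add: n_def)
  finally have "card (\<Union>i\<in>I. Z i) < card C" .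
  moreover have "finite (\<Union>i\<in>I. Z i)"
    using \<open>finite I\<close> finC by (simp add: Z_def)
  ultimately have "\<not> C \<subseteq> (\<Union>i\<in>I. Z i)"
    using card_mono leD by blast
  then obtain c where "c \<in> C" "\<forall>i\<in>I. c \<notin> Z i" by blast
  then show ?thesis by (intro exI[of _ "s c"]) (simp add: Z_def)
qed simp

definition close_homs :: "nat \<Rightarrow> ('a \<Rightarrow> 'b::ab_group_add) \<Rightarrow> ('a \<Rightarrow> 'b) \<Rightarrow> bool" where
  "close_homs q u v \<longleftrightarrow> finite (range (\<lambda>x. u x - v x)) \<and> card (range (\<lambda>x. u x - v x)) \<le> q"

lemma close_homs_sym: "close_homs q u v = close_homs q v u"
proof -
  have "range (\<lambda>x. v x - u x) = uminus ` range (\<lambda>x. u x - v x)"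
    by (simp add: image_image)
  then show ?thesis
    unfolding close_homs_def by (simp add: finite_image_iff card_image)
qed

lemma close_homs_refl: "q > 0 \<Longrightarrow> close_homs q u u"
  by (simp add: close_homs_def)

lemma additive_diff: "additive u \<Longrightarrow> additive v \<Longrightarrow> additive (\<lambda>x. u x - v x)"
  unfolding additive_def by simp

text \<open>
  Two members of \<open>S\<close> agree at \<open>x\<close> iff \<open>x\<close> lies in the kernel of their difference, and there are
  at most \<open>q\<close> such kernels, each of index greater than \<open>q\<close>.
\<close>

lemma ex_separating_point:
  fixes S :: "('a::ab_group_add \<Rightarrow> 'b::ab_group_add) set"
  assumes "finite S" "card S * card S \<le> q" "\<And>u. u \<in> S \<Longrightarrow> additive u"
    and far: "\<And>u v. u \<in> S \<Longrightarrow> v \<in> S \<Longrightarrow> u \<noteq> v \<Longrightarrow> \<not> close_homs q u v"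
  shows "\<exists>x. inj_on (\<lambda>u. u x) S"
proof -
  define I where "I = {p \<in> S \<times> S. fst p \<noteq> snd p}"
  have "finite I" using assms(1) by (simp add: I_def)
  have "card I \<le> card (S \<times> S)"
    using assms(1) by (intro card_mono) (auto simp: I_def)
  then have "card I \<le> q" using assms(2) by (simp add: card_cartesian_product)
  have "\<exists>x. \<forall>p\<in>I. fst p x - snd p x \<noteq> 0"
  proof (rule ex_nonzero_of_large_ranges[OF \<open>finite I\<close>])
    fix p assume p: "p \<in> I"
    then show "additive (\<lambda>x. fst p x - snd p x)"
      using assms(3) by (intro additive_diff) (auto simp: I_def)
    assume "finite (range (\<lambda>x. fst p x - snd p x))"
    moreover have "\<not> close_homs q (fst p) (snd p)"
      using far p by (auto simp: I_def)
    ultimately show "card I < card (range (\<lambda>x. fst p x - snd p x))"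
      using \<open>card I \<le> q\<close> by (simp add: close_homs_def)
  qed
  then obtain x where x: "\<And>p. p \<in> I \<Longrightarrow> fst p x - snd p x \<noteq> 0" by blast
  have "u = v" if "u \<in> S" "v \<in> S" "u x = v x" for u v
    using x[of "(u, v)"] that by (auto simp: I_def)
  then show ?thesis
    by (blast intro: inj_onI)
qed

text \<open>
  A family of pairwise far homomorphisms is separated by a single point \<open>x\<close>, where at most \<open>m\<close>
  values are available; hence such a family has at most \<open>m\<close> members, and a family of maximal size
  comes close to everything. Closeness is not transitive, which is why a maximal family takes the
  place of equivalence classes.
\<close>

lemma finitely_many_close_classes:
  fixes \<F> :: "('a::ab_group_add \<Rightarrow> 'b::ab_group_add) set"
  assumes additive: "\<And>u. u \<in> \<F> \<Longrightarrow> additive u"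
    and fin: "\<And>x. finite (V x)" and card: "\<And>x. card (V x) \<le> m"
    and V: "\<And>u x. u \<in> \<F> \<Longrightarrow> u x \<in> V x"
  obtains S where "finite S" "S \<subseteq> \<F>" "\<And>u. u \<in> \<F> \<Longrightarrow> \<exists>v\<in>S. close_homs (Suc m * Suc m) u v"
proof -
  let ?q = "Suc m * Suc m"
  define far where
    "far S \<longleftrightarrow> finite S \<and> S \<subseteq> \<F> \<and> (\<forall>u\<in>S. \<forall>v\<in>S. u \<noteq> v \<longrightarrow> \<not> close_homs ?q u v)" for S
  have bound: "card S \<le> m" if "far S" for S
  proof (rule ccontr)
    assume "\<not> card S \<le> m"
    then obtain S' where S': "S' \<subseteq> S" "card S' = Suc m" "finite S'"
      by (metis not_less_eq_eq obtain_subset_with_card_n)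
    have "\<exists>x. inj_on (\<lambda>u. u x) S'"
    proof (rule ex_separating_point[of S' ?q])
      show "card S' * card S' \<le> ?q" using S'(2) by simp
      show "additive u" if "u \<in> S'" for u
        using that S'(1) \<open>far S\<close> additive unfolding far_def by blast
      show "\<not> close_homs ?q u v" if "u \<in> S'" "v \<in> S'" "u \<noteq> v" for u v
        using that S'(1) \<open>far S\<close> unfolding far_def by blast
    qed fact
    then obtain x where x: "inj_on (\<lambda>u. u x) S'" ..
    have "(\<lambda>u. u x) ` S' \<subseteq> V x"
      using S' that V unfolding far_def by blast
    then have "card S' \<le> card (V x)"
      using x fin card_inj_on_le by blast
    with S' card[of x] show False by simp
  qed
  have "far {}" by (simp add: far_def)
  then obtain S where S: "far S" "\<And>S'. far S' \<Longrightarrow> card S' \<le> card S"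
    using ex_has_greatest_nat[of far "{}" card "Suc m"] bound by (metis le_imp_less_Suc)
  show ?thesis
  proof
    show "finite S" "S \<subseteq> \<F>" using S(1) by (auto simp: far_def)
    fix u assume u: "u \<in> \<F>"
    show "\<exists>v\<in>S. close_homs ?q u v"
    proof (rule ccontr)
      assume *: "\<not> (\<exists>v\<in>S. close_homs ?q u v)"
      then have "u \<notin> S" using close_homs_refl[of ?q u] by auto
      moreover have "\<not> close_homs ?q u v" "\<not> close_homs ?q v u" if "v \<in> S" for v
        using * that close_homs_sym[of ?q u v] by blast+
      then have "far (insert u S)"
        using S(1) u unfolding far_def by simp
      ultimately show False
        using S(2)[of "insert u S"] \<open>finite S\<close> by simp
    qed
  qed
qed

abbreviation multiple :: "nat \<Rightarrow> 'a::ab_group_add \<Rightarrow> 'a" where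
  "multiple n x \<equiv> (\<Sum>i<n. x)"

lemma multiple_add: "multiple (m + n) x = multiple m x + multiple n x"
  by (induction n) (simp_all add: add.assoc)

lemma multiple_mult: "multiple (m * n) x = multiple n (multiple m x)"
  by (induction n) (simp_all add: multiple_add add.commute)

text \<open>
  Lagrange's theorem for a finite subgroup: adding \<open>y\<close> permutes \<open>K\<close>, so it does not change the
  sum of all elements of \<open>K\<close>, although each summand increases by \<open>y\<close>.
\<close>

lemma multiple_card_eq_0:
  fixes K :: "'a::ab_group_add set"
  assumes "finite K" "y \<in> K" and add: "\<And>a b. a \<in> K \<Longrightarrow> b \<in> K \<Longrightarrow> a + b \<in> K"
  shows "multiple (card K) y = 0"
proof -
  have inj: "inj_on (\<lambda>z. z + y) K" by simp
  have "(\<lambda>z. z + y) ` K = K"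
    using inj assms by (intro card_subset_eq) (auto simp: card_image)
  then have "(\<Sum>z\<in>K. z) = (\<Sum>z\<in>K. z + y)"
    by (metis (no_types, lifting) inj sum.reindex_cong)
  then have "(\<Sum>z\<in>K. y) = 0" by (simp add: sum.distrib)
  moreover obtain b where "bij_betw b {0..<card K} K"
    using ex_bij_betw_nat_finite[OF assms(1)] by blast
  then have "(\<Sum>i\<in>{0..<card K}. y) = (\<Sum>z\<in>K. y)"
    by (rule sum.reindex_bij_betw)
  ultimately show ?thesis by (simp add: atLeast0LessThan)
qed

text \<open>
  The range of \<open>u - v\<close> is a finite group whose order divides \<open>fact q\<close>, so \<open>u - v\<close> vanishes on
  multiples of \<open>fact q\<close>.
\<close>

lemma close_homs_eq_on_multiples:
  assumes "additive u" "additive v" "close_homs q u v"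
  shows "u (multiple (fact q) x) = v (multiple (fact q) x)"
proof -
  define d where "d x = u x - v x" for x
  interpret d: additive d unfolding d_def by (rule additive_diff) fact+
  let ?r = "card (range d)"
  have fin: "finite (range d)" and le: "?r \<le> q"
    using assms(3) by (simp_all add: close_homs_def d_def)
  have "1 \<le> ?r" using fin by (simp add: Suc_leI card_gt_0_iff)
  then obtain k where k: "fact q = ?r * k" using le dvd_fact by (metis dvd_def)
  have "multiple ?r (d x) = 0"
    by (rule multiple_card_eq_0[OF fin]) (auto simp: d.add[symmetric])
  then have "multiple (fact q) (d x) = 0"
    unfolding k multiple_mult by simp
  then have "d (multiple (fact q) x) = 0" by (simp add: d.sum)
  then show ?thesis by (simp add: d_def)
qed

text \<open>
  On multiples of \<open>n\<close>, members of \<open>\<F>\<close> that are close to each other coincide, so only finitely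
  many restrictions remain. One point for each restriction that differs from \<open>f\<close> suffices to
  detect the difference.
\<close>

lemma finite_test_set:
  fixes \<F> :: "('a::ab_group_add \<Rightarrow> 'b::ab_group_add) set"
  assumes "\<And>u. u \<in> \<F> \<Longrightarrow> additive u"
    and "\<And>x. finite (V x)" and "\<And>x. card (V x) \<le> m"
    and "\<And>u x. u \<in> \<F> \<Longrightarrow> u x \<in> V x"
  obtains n T where "n \<ge> 1" "finite T"
    "\<forall>u\<in>\<F>. (\<forall>t\<in>T. u t = f t) \<longrightarrow> (\<forall>x. u (multiple n x) = f (multiple n x))"
proof -
  obtain S where S: "finite S" "S \<subseteq> \<F>" "\<And>u. u \<in> \<F> \<Longrightarrow> \<exists>v\<in>S. close_homs (Suc m * Suc m) u v"
    using finitely_many_close_classes[of \<F> V m] assms by blast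
  define n :: nat where "n = fact (Suc m * Suc m)"
  define s where "s v = (SOME x. v (multiple n x) \<noteq> f (multiple n x))" for v
  define t where "t v = multiple n (s v)" for v
  have t: "v (multiple n x) = f (multiple n x)" if "v (t v) = f (t v)" for v x
    using someI[of "\<lambda>x. v (multiple n x) \<noteq> f (multiple n x)" x] that unfolding t_def s_def by blast
  show ?thesis
  proof
    show "n \<ge> 1" unfolding n_def by (rule fact_ge_1)
    show "finite (t ` S)" using S(1) by simp
    show "\<forall>u\<in>\<F>. (\<forall>y\<in>t ` S. u y = f y) \<longrightarrow> (\<forall>x. u (multiple n x) = f (multiple n x))"
    proof (intro ballI impI allI)
      fix u x assume u: "u \<in> \<F>" "\<forall>y\<in>t ` S. u y = f y"
      obtain v where v: "v \<in> S" "close_homs (Suc m * Suc m) u v" using S(3) u(1) by blast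
      have uv: "u (multiple n x) = v (multiple n x)" for x
        unfolding n_def using v(1) S(2)
        by (intro close_homs_eq_on_multiples[OF assms(1)[OF u(1)] assms(1) v(2)]) auto
      have "v (t v) = u (t v)"
        unfolding t_def by (rule uv[symmetric])
      also have "\<dots> = f (t v)"
        using v(1) by (intro u(2)[rule_format] imageI)
      finally show "u (multiple n x) = f (multiple n x)"
        unfolding uv by (rule t)
    qed
  qed
qed

text \<open>
  Compactness: by Tychonoff's theorem the product of the finite fibres of \<open>R\<close> is compact, and for
  each pair \<open>(x, y)\<close> the condition \<open>u (x + y) = u x + u y\<close> is closed, since it involves three
  coordinates only.
\<close>

lemma ex_hom_selection:
  fixes R :: "'a::ab_group_add \<Rightarrow> 'b::ab_group_add \<Rightarrow> bool"
  assumes fin: "\<And>x. finite {y. R x y}"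
    and partial: "\<And>S. finite S \<Longrightarrow> \<exists>u. (\<forall>x\<in>S. R x (u x)) \<and>
       (\<forall>x\<in>S. \<forall>y\<in>S. x + y \<in> S \<longrightarrow> u (x + y) = u x + u y)"
  shows "\<exists>u. additive u \<and> (\<forall>x. R x (u x))"
proof -
  let ?X = "product_topology (\<lambda>x. discrete_topology {y. R x y}) UNIV"
  define C where "C p = {u \<in> topspace ?X. u (fst p + snd p) = u (fst p) + u (snd p)}"
    for p :: "'a \<times> 'a"
  have top: "topspace ?X = {u. \<forall>x. R x (u x)}"
    by (auto simp: PiE_UNIV_domain)
  have "\<exists>y. R x y" for x
    using partial[of "{x}"] by auto
  then obtain w where w: "R x (w x)" for x
    by metis
  have "compact_space ?X"
    unfolding compact_space_product_topology by (simp add: compact_space_discrete_topology fin)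
  moreover have "closedin ?X (C p)" for p
  proof -
    have op: "openin ?X {u \<in> topspace ?X. u x = a}" if "R x a" for x a
      using openin_continuous_map_preimage[OF continuous_map_product_projection, of x UNIV
          "\<lambda>x. discrete_topology {y. R x y}" "{a}"] that by simp
    have "\<exists>U. openin ?X U \<and> u \<in> U \<and> U \<subseteq> topspace ?X - C p" if u: "u \<in> topspace ?X - C p" for u
    proof -
      let ?U = "\<lambda>x. {v \<in> topspace ?X. v x = u x}"
      have "openin ?X (?U x)" for x
        using u unfolding top by (intro op[unfolded top]) blast
      then have "openin ?X (?U (fst p) \<inter> ?U (snd p) \<inter> ?U (fst p + snd p))"
        by (intro openin_Int)
      moreover have "?U (fst p) \<inter> ?U (snd p) \<inter> ?U (fst p + snd p) \<subseteq> topspace ?X - C p"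
      proof
        fix v assume v: "v \<in> ?U (fst p) \<inter> ?U (snd p) \<inter> ?U (fst p + snd p)"
        then have "v (fst p + snd p) \<noteq> v (fst p) + v (snd p)"
          using u unfolding C_def by simp
        then show "v \<in> topspace ?X - C p"
          using v unfolding C_def by blast
      qed
      moreover have "u \<in> ?U (fst p) \<inter> ?U (snd p) \<inter> ?U (fst p + snd p)"
        using u by blast
      ultimately show ?thesis by blast
    qed
    then have "openin ?X (topspace ?X - C p)"
      by (subst openin_subopen) blast
    then show ?thesis unfolding closedin_def by (auto simp: C_def)
  qed
  moreover have "\<Inter> \<G> \<noteq> {}" if \<G>: "finite \<G>" "\<G> \<subseteq> range C" for \<G>
  proof -
    obtain P where P: "finite P" "\<G> = C ` P" using finite_subset_image[OF \<G>] by blast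
    define S where "S = fst ` P \<union> snd ` P \<union> (\<lambda>p. fst p + snd p) ` P"
    obtain u where u: "\<forall>x\<in>S. R x (u x)" "\<forall>x\<in>S. \<forall>y\<in>S. x + y \<in> S \<longrightarrow> u (x + y) = u x + u y"
      using partial[of S] P(1) by (auto simp: S_def)
    define u' where "u' x = (if x \<in> S then u x else w x)" for x
    have "u' \<in> C p" if "p \<in> P" for p
      using that u w unfolding C_def top u'_def S_def by auto
    then show ?thesis unfolding P(2) by blast
  qed
  ultimately have "\<Inter> (range C) \<noteq> {}"
    unfolding compact_space_fip by (elim allE[of _ "range C"]) auto
  then obtain u where "u \<in> \<Inter> (range C)" by blast
  then have u: "u \<in> C (x, y)" for x y by blast
  have "additive u"
    unfolding additive_def using u unfolding C_def by simp
  moreover have "\<forall>x. R x (u x)"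
    using u unfolding C_def top by blast
  ultimately show ?thesis by blast
qed

section \<open>Uniform algebraicity\<close>

text \<open>
  Expresses a bound on the size of a set by quantifiers over elements, so that it can be part of a
  first-order formula.
\<close>

lemma ex_enumeration_iff:
  "(\<exists>v :: nat \<Rightarrow> 'a. \<forall>y\<in>Y. \<exists>i<m. y = v i) \<longleftrightarrow> finite Y \<and> card Y \<le> m"
proof
  assume "\<exists>v :: nat \<Rightarrow> 'a. \<forall>y\<in>Y. \<exists>i<m. y = v i"
  then obtain v :: "nat \<Rightarrow> 'a" where v: "\<forall>y\<in>Y. \<exists>i<m. y = v i" ..
  then have sub: "Y \<subseteq> v ` {..<m}" by auto
  then have "card Y \<le> card (v ` {..<m})" by (intro card_mono) auto
  also have "\<dots> \<le> m" using card_image_le[of "{..<m}" v] by simp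
  finally show "finite Y \<and> card Y \<le> m" using finite_subset[OF sub] by simp
next
  assume Y: "finite Y \<and> card Y \<le> m"
  then obtain b where b: "bij_betw b {0..<card Y} Y"
    using ex_bij_betw_nat_finite by blast
  have "\<exists>i<m. y = b i" if "y \<in> Y" for y
  proof -
    have "y \<in> b ` {0..<card Y}" using b that by (simp add: bij_betw_def)
    then obtain i where "i < card Y" "y = b i" by auto
    then show ?thesis using Y by (intro exI[of _ i]) simp
  qed
  then show "\<exists>v :: nat \<Rightarrow> 'a. \<forall>y\<in>Y. \<exists>i<m. y = v i" by blast
qed

lemma definable_fibre_bound:
  fixes M :: "('f, 'r, 'a) fo_structure"
  assumes "definable_rel M A R"
  shows "definable_pred M A (\<lambda>e :: nat \<Rightarrow> 'a. finite {y. R (e 0) y} \<and> card {y. R (e 0) y} \<le> m)"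
proof -
  have "definable_pred M A (\<lambda>e :: nat \<Rightarrow> 'a. \<exists>v :: nat \<Rightarrow> 'a. \<forall>y :: nat \<Rightarrow> 'a.
      R (e 0) (y 0) \<longrightarrow> (\<exists>i\<in>{..<m}. y 0 = v i))"
    by (intro definable_pred_ex definable_pred_all definable_pred_imp definable_pred_bex
        definable_pred_eq definable_rel_reindex[OF assms] finite_lessThan)
  moreover have "(\<forall>y :: nat \<Rightarrow> 'a. R x (y 0) \<longrightarrow> (\<exists>i\<in>{..<m}. y 0 = v i)) \<longleftrightarrow>
      (\<forall>y\<in>{y. R x y}. \<exists>i<m. y = v i)" for x and v :: "nat \<Rightarrow> 'a"
  proof
    assume *: "\<forall>y :: nat \<Rightarrow> 'a. R x (y 0) \<longrightarrow> (\<exists>i\<in>{..<m}. y 0 = v i)"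
    show "\<forall>y\<in>{y. R x y}. \<exists>i<m. y = v i"
      using *[rule_format, of "\<lambda>_. y" for y] by auto
  qed auto
  ultimately show ?thesis
    unfolding ex_enumeration_iff[symmetric] by (simp only:)
qed

definition bounded_rels :: "('f, 'r, 'a) fo_structure \<Rightarrow> 'a set \<Rightarrow> ('a \<Rightarrow> 'a \<Rightarrow> bool) set" where
  "bounded_rels M F =
     {R. definable_rel M F R \<and> (\<exists>m. \<forall>x. finite {y. R x y} \<and> card {y. R x y} \<le> m)}"

lemma bounded_rels_union:
  assumes "finite \<R>" "\<R> \<subseteq> bounded_rels M F"
  shows "(\<lambda>x y. \<exists>R\<in>\<R>. R x y) \<in> bounded_rels M F"
proof -
  have "\<forall>R\<in>\<R>. \<exists>m. \<forall>x. finite {y. R x y} \<and> card {y. R x y} \<le> m"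
    using assms(2) unfolding bounded_rels_def by blast
  then obtain m where m: "\<And>R x. R \<in> \<R> \<Longrightarrow> finite {y. R x y} \<and> card {y. R x y} \<le> m R"
    by metis
  have eq: "{y. \<exists>R\<in>\<R>. R x y} = (\<Union>R\<in>\<R>. {y. R x y})" for x by blast
  have "finite {y. \<exists>R\<in>\<R>. R x y}" for x
    unfolding eq using assms(1) m by blast
  moreover have "card {y. \<exists>R\<in>\<R>. R x y} \<le> (\<Sum>R\<in>\<R>. m R)" for x
    unfolding eq using m by (intro order_trans[OF card_UN_le[OF assms(1)]] sum_mono) blast
  moreover have "definable_rel M F (\<lambda>x y. \<exists>R\<in>\<R>. R x y)"
    using assms unfolding bounded_rels_def by (intro definable_pred_bex) auto
  ultimately show ?thesis unfolding bounded_rels_def by blast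
qed

lemma acl_imp_bounded_rel:
  fixes M :: "('f, 'r, 'a) fo_structure"
  assumes "b \<in> acl M (F \<union> {g})"
  shows "\<exists>R\<in>bounded_rels M F. R g b"
proof -
  obtain X where X: "definable_over M (insert g F) 1 X" "finite X" "[b] \<in> X"
    using assms unfolding acl_def by auto
  have "definable_pred M (insert g F) (\<lambda>e :: nat \<Rightarrow> 'a. [e 0] \<in> X)"
    using definable_over_imp_definable_pred[OF X(1)] by simp
  then obtain Q where Q: "definable_pred M F (\<lambda>e. Q (e None) (\<lambda>j. e (Some j)))"
    "\<And>e :: nat \<Rightarrow> 'a. [e 0] \<in> X \<longleftrightarrow> Q g e"
    by (rule definable_pred_abstract_param) blast
  define m where "m = card {y. [y] \<in> X}"
  define R where "R x y \<longleftrightarrow> Q x (\<lambda>_. y)" for x y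
  have R: "definable_rel M F R"
    using definable_pred_reindex[OF Q(1), of "case_option 0 (\<lambda>_. 1 :: nat)"] by (simp add: R_def)
  (* Fibres of R other than the one above g may be infinite; R' discards the fibres that are
     larger than the one above g. *)
  define R' where "R' x y \<longleftrightarrow> R x y \<and> finite {y. R x y} \<and> card {y. R x y} \<le> m" for x y
  have "definable_rel M F R'"
    unfolding R'_def by (rule definable_pred_conj[OF R definable_fibre_bound[OF R]])
  moreover have "finite {y. R' x y} \<and> card {y. R' x y} \<le> m" for x
  proof (cases "finite {y. R x y} \<and> card {y. R x y} \<le> m")
    case False
    then have "{y. R' x y} = {}" unfolding R'_def by blast
    then show ?thesis by simp
  qed (simp add: R'_def)
  moreover have "R' g b"
  proof -
    have R_g: "R g y \<longleftrightarrow> [y] \<in> X" for y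
      using Q(2)[of "\<lambda>_. y"] by (simp add: R_def)
    have "finite {y. [y] \<in> X}"
      using finite_vimageI[OF X(2), of "\<lambda>y. [y]"] by (simp add: vimage_def inj_def)
    then show ?thesis using X(3) by (simp add: R'_def R_g m_def)
  qed
  ultimately show ?thesis unfolding bounded_rels_def by blast
qed

text \<open>
  A priori the relation that witnesses \<open>f g \<in> acl M (F \<union> {g})\<close> depends on \<open>g\<close>. If no finite
  union of such relations worked for all \<open>g\<close>, then saturation of \<open>N\<close>, where \<open>f\<close> is definable,
  would give one element at which all of them fail.
\<close>

lemma uniformly_algebraic:
  fixes N :: "('f, 'r, 'a) fo_structure" and M :: "('g, 's, 'a) fo_structure"
  assumes "omega_saturated N" "is_zero_expansion N M" "finite F" "finite C"
    and f: "definable_rel N C (\<lambda>x y. y = f x)"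
    and acl: "\<And>g. f g \<in> acl M (F \<union> {g})"
  shows "\<exists>R\<in>bounded_rels M F. \<forall>g. R g (f g)"
proof (rule ccontr)
  assume none: "\<not> ?thesis"
  define \<P> where "\<P> = (\<lambda>R g. \<not> R g (f g)) ` bounded_rels M F"
  have "\<exists>a. \<forall>P\<in>\<P>. P a"
  proof (rule saturated_realizes[OF assms(1)])
    show "finite (F \<union> C)" using assms by simp
    fix P assume "P \<in> \<P>"
    then obtain R where R: "definable_rel M F R" "P = (\<lambda>g. \<not> R g (f g))"
      unfolding \<P>_def bounded_rels_def by blast
    have RN: "definable_rel N (F \<union> C) R"
      using definable_pred_zero_expansion[OF assms(2) R(1)] by (rule definable_pred_mono) simp
    have fN: "definable_rel N (F \<union> C) (\<lambda>x y. y = f x)"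
      using f by (rule definable_pred_mono) simp
    have P: "P = (\<lambda>x. \<exists>v :: nat \<Rightarrow> 'a. v 0 = f x \<and> \<not> R x (v 0))"
      unfolding R(2) by (auto intro!: ext exI[of _ "\<lambda>_. f _"])
    show "definable_pred N (F \<union> C) (\<lambda>e :: nat \<Rightarrow> 'a. P (e 0))"
      unfolding P by (intro definable_pred_ex definable_pred_conj definable_pred_not
          definable_rel_reindex[OF RN] definable_rel_reindex[OF fN])
  next
    fix \<Q> assume "\<Q> \<subseteq> \<P>" "finite \<Q>"
    from finite_subset_image[OF this(2) this(1)[unfolded \<P>_def]]
    obtain \<R> where \<R>: "\<R> \<subseteq> bounded_rels M F" "finite \<R>" "\<Q> = (\<lambda>R g. \<not> R g (f g)) ` \<R>"
      by (elim exE conjE) (rule that)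
    have "\<not> (\<forall>g. \<exists>R\<in>\<R>. R g (f g))"
      using none bexI[of "\<lambda>R. \<forall>g. R g (f g)", OF _ bounded_rels_union[OF \<R>(2,1)]] by argo
    then show "\<exists>a. \<forall>P\<in>\<Q>. P a" unfolding \<R>(3) by simp
  qed
  then obtain a where a: "\<forall>R\<in>bounded_rels M F. \<not> R a (f a)"
    unfolding \<P>_def by auto
  obtain R where R: "R \<in> bounded_rels M F" "R a (f a)"
    using acl_imp_bounded_rel[OF acl] by (rule bexE)
  from bspec[OF a R(1)] R(2) show False by (rule notE)
qed

section \<open>Definability of the homomorphism\<close>

lemma definable_multiple:
  fixes M :: "('f, 'r, 'a::ab_group_add) fo_structure"
  assumes add: "definable_add M A" and "0 \<in> A"
  shows "definable_pred M A (\<lambda>e. e i = multiple n (e j))"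
proof -
  have "definable_pred M A (\<lambda>e. \<exists>v :: nat \<Rightarrow> 'a.
      v 0 = 0 \<and> (\<forall>k\<in>{..<n}. v k + e j = v (Suc k)) \<and> v n = e i)"
    by (intro definable_pred_ex definable_pred_conj definable_pred_ball definable_pred_eq
        definable_pred_eq_const definable_add_reindex[OF add] \<open>0 \<in> A\<close>) simp
  moreover have "(\<exists>v. v 0 = 0 \<and> (\<forall>k\<in>{..<n}. v k + x = v (Suc k)) \<and> v n = y) \<longleftrightarrow> y = multiple n x"
    for x y :: 'a
  proof
    assume "\<exists>v. v 0 = 0 \<and> (\<forall>k\<in>{..<n}. v k + x = v (Suc k)) \<and> v n = y"
    then obtain v where v: "v 0 = 0" "\<And>k. k < n \<Longrightarrow> v k + x = v (Suc k)" "v n = y" by auto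
    have "k \<le> n \<Longrightarrow> v k = multiple k x" for k
      by (induction k) (simp_all add: v(1) v(2)[symmetric])
    then show "y = multiple n x" using v(3) by blast
  next
    assume "y = multiple n x"
    then show "\<exists>v. v 0 = 0 \<and> (\<forall>k\<in>{..<n}. v k + x = v (Suc k)) \<and> v n = y"
      by (intro exI[of _ "\<lambda>k. multiple k x"]) simp
  qed
  ultimately show ?thesis by simp
qed

text \<open>
  A first-order approximation to the existence of a homomorphism that selects a point from each
  fibre of \<open>R\<close>: every \<open>k\<close>-tuple \<open>h\<close> admits a choice of points in the fibres above it that
  respects all additions visible within the tuple.
\<close>

definition partial_hom_selections ::
    "nat \<Rightarrow> ('a::ab_group_add \<Rightarrow> 'b::ab_group_add \<Rightarrow> bool) \<Rightarrow> bool" where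
  "partial_hom_selections k R \<longleftrightarrow>
     (\<forall>h. \<exists>v. (\<forall>i<k. R (h i) (v i)) \<and>
        (\<forall>i<k. \<forall>j<k. \<forall>l<k. h i + h j = h l \<longrightarrow> v i + v j = v l))"

lemma partial_hom_selectionsE:
  assumes "partial_hom_selections k R"
  obtains v where "\<forall>i<k. R (h i) (v i)"
    "\<forall>i<k. \<forall>j<k. \<forall>l<k. h i + h j = h l \<longrightarrow> v i + v j = v l"
  using assms unfolding partial_hom_selections_def by (elim allE[of _ h] exE conjE) (rule that)

lemma partial_hom_selections_antimono:
  assumes "partial_hom_selections k R" "k' \<le> k"
  shows "partial_hom_selections k' R"
  unfolding partial_hom_selections_def
proof
  fix h
  obtain v where v: "\<forall>i<k. R (h i) (v i)"
      "\<forall>i<k. \<forall>j<k. \<forall>l<k. h i + h j = h l \<longrightarrow> v i + v j = v l"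
    using assms(1) by (rule partial_hom_selectionsE)
  show "\<exists>v. (\<forall>i<k'. R (h i) (v i)) \<and>
      (\<forall>i<k'. \<forall>j<k'. \<forall>l<k'. h i + h j = h l \<longrightarrow> v i + v j = v l)"
    using v less_le_trans[OF _ assms(2)] by (intro exI[of _ v]) simp
qed

lemma partial_hom_selections_of_hom:
  assumes "additive u" "\<And>x. R x (u x)"
  shows "partial_hom_selections k R"
  unfolding partial_hom_selections_def
proof
  fix h
  show "\<exists>v. (\<forall>i<k. R (h i) (v i)) \<and>
      (\<forall>i<k. \<forall>j<k. \<forall>l<k. h i + h j = h l \<longrightarrow> v i + v j = v l)"
    by (rule exI[of _ "\<lambda>i. u (h i)"]) (simp add: assms(2) additive.add[OF assms(1), symmetric])
qed

lemma hom_of_partial_hom_selections: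
  assumes fin: "\<And>x. finite {y. R x y}" and R: "\<And>k. partial_hom_selections k R"
  obtains u where "additive u" "\<And>x. R x (u x)"
proof -
  have "\<exists>u. (\<forall>x\<in>S. R x (u x)) \<and> (\<forall>x\<in>S. \<forall>y\<in>S. x + y \<in> S \<longrightarrow> u (x + y) = u x + u y)"
    if "finite S" for S
  proof -
    obtain h where h: "bij_betw h {0..<card S} S"
      using ex_bij_betw_nat_finite[OF \<open>finite S\<close>] by blast
    obtain v where v: "\<forall>i<card S. R (h i) (v i)"
      "\<forall>i<card S. \<forall>j<card S. \<forall>l<card S. h i + h j = h l \<longrightarrow> v i + v j = v l"
      using R by (rule partial_hom_selectionsE)
    have "\<exists>i. i < card S \<and> h i = x" if "x \<in> S" for x
    proof -
      have "x \<in> h ` {0..<card S}" using that h by (simp add: bij_betw_def)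
      then show ?thesis by auto
    qed
    then obtain idx where idx: "\<And>x. x \<in> S \<Longrightarrow> idx x < card S" "\<And>x. x \<in> S \<Longrightarrow> h (idx x) = x"
      by metis
    have "R x (v (idx x))" if "x \<in> S" for x
      using v(1)[rule_format, of "idx x"] idx that by simp
    moreover have "v (idx (x + y)) = v (idx x) + v (idx y)" if "x \<in> S" "y \<in> S" "x + y \<in> S" for x y
      using v(2)[rule_format, of "idx x" "idx y" "idx (x + y)"] idx that by simp
    ultimately show ?thesis by (intro exI[of _ "\<lambda>x. v (idx x)"]) blast
  qed
  then have "\<exists>u. additive u \<and> (\<forall>x. R x (u x))"
    by (intro ex_hom_selection fin)
  then show ?thesis using that by blast
qed

lemma definable_partial_hom_selections:
  fixes M :: "('f, 'r, 'a::ab_group_add) fo_structure"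
  assumes add: "definable_add M A"
    and Q: "definable_pred M A (\<lambda>e :: nat \<Rightarrow> 'a. Q (e 0) (e 1) (e 2) (e 3))"
  shows "definable_rel M A (\<lambda>x y. partial_hom_selections k (Q x y))"
proof -
  have Q': "definable_pred M A (\<lambda>e. Q (e i) (e j) (e l) (e m))" for i j l m
    using definable_pred_reindex[OF Q,
        of "\<lambda>n. if n = 0 then i else if n = 1 then j else if n = 2 then l else m"] by simp
  have "definable_rel M A (\<lambda>x y. \<forall>h :: nat \<Rightarrow> 'a. \<exists>v :: nat \<Rightarrow> 'a. (\<forall>i\<in>{..<k}. Q x y (h i) (v i)) \<and>
      (\<forall>i\<in>{..<k}. \<forall>j\<in>{..<k}. \<forall>l\<in>{..<k}. h i + h j = h l \<longrightarrow> v i + v j = v l))"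
    by (intro definable_pred_all definable_pred_ex definable_pred_conj definable_pred_ball
        definable_pred_imp definable_add_reindex[OF add] Q') simp_all
  then show ?thesis
    unfolding partial_hom_selections_def by (simp add: Ball_def)
qed

lemma finite_coset_representatives:
  assumes "small_quotients TYPE('a::ab_group_add)" "n \<ge> 1"
  obtains G0 :: "'a::ab_group_add set" where "finite G0" "\<And>x. \<exists>g\<in>G0. \<exists>a. x = g + multiple n a"
proof -
  let ?c = "\<lambda>x :: 'a. (+) x ` multiples n"
  have "finite (range ?c)"
    using assms unfolding small_quotients_def by blast
  then obtain G0 where G0: "finite G0" "?c ` UNIV = ?c ` G0"
    using finite_subset_image[of "range ?c" ?c UNIV] by blast
  have "\<exists>g\<in>G0. \<exists>a. x = g + multiple n a" for x
  proof -
    have "multiple n 0 \<in> (multiples n :: 'a set)"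
      unfolding multiples_def by blast
    then have x: "x \<in> ?c x" by (simp add: image_iff)
    have "?c x \<in> ?c ` G0" unfolding G0(2)[symmetric] by (rule rangeI)
    then obtain g where g: "?c x = ?c g" "g \<in> G0" by (rule imageE)
    obtain a where "x = g + multiple n a"
      using x[unfolded g(1)] by (auto simp: multiples_def)
    then show ?thesis using g(2) by blast
  qed
  with G0(1) show ?thesis by (rule that)
qed

text \<open>
  The homomorphisms with graph in \<open>R\<close> that agree with \<open>f\<close> on the finite set \<open>T\<close> all agree with
  \<open>f\<close> on multiples of \<open>n\<close>. So \<open>y = f (na)\<close> iff some such homomorphism takes the value \<open>y\<close> at
  \<open>na\<close>. The relation \<open>Q a y\<close> below encodes these constraints, and the existence of the
  homomorphism is equivalent to all the approximations \<open>partial_hom_selections k (Q a y)\<close>.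
  Each of them is definable in \<open>M\<close>; saturation of \<open>N\<close> shows that one of them is enough.
\<close>

lemma definable_on_multiples:
  fixes N :: "('f, 'r, 'a::ab_group_add) fo_structure" and M :: "('g, 's, 'a) fo_structure"
  assumes sat: "omega_saturated N" and exp: "is_zero_expansion N M"
    and finA: "finite A" and add: "definable_add M A" and "0 \<in> A"
    and "finite C" and fN: "definable_rel N C (\<lambda>x y. y = f x)"
    and "additive f"
    and R: "R \<in> bounded_rels M A" and Rf: "\<And>x. R x (f x)"
  obtains n D where "n \<ge> 1" "definable_rel M D (\<lambda>a y. y = f (multiple n a))"
proof -
  obtain m where m: "\<And>x. finite {y. R x y}" "\<And>x. card {y. R x y} \<le> m"
    using R unfolding bounded_rels_def by blast
  let ?\<F> = "{u. additive u \<and> (\<forall>x. R x (u x))}"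
  obtain n T where n: "n \<ge> 1" and T: "finite T"
    "\<forall>u\<in>?\<F>. (\<forall>t\<in>T. u t = f t) \<longrightarrow> (\<forall>x. u (multiple n x) = f (multiple n x))"
    by (rule finite_test_set[of ?\<F> "\<lambda>x. {y. R x y}" m f]) (use m in auto)
  define Q where
    "Q a y x z \<longleftrightarrow> R x z \<and> (\<forall>t\<in>T. x = t \<longrightarrow> z = f t) \<and> (x = multiple n a \<longrightarrow> z = y)" for a y x z
  define D where "D = A \<union> T \<union> f ` T"
  have "finite D" by (simp add: D_def finA T(1))
  have "0 \<in> D" using \<open>0 \<in> A\<close> by (simp add: D_def)
  have addD: "definable_add M D"
    using add by (rule definable_pred_mono) (auto simp: D_def)
  have RD: "definable_rel M D R"
    using R unfolding bounded_rels_def by (auto intro: definable_pred_mono simp: D_def)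
  have "definable_pred M D (\<lambda>e :: nat \<Rightarrow> 'a. Q (e 0) (e 1) (e 2) (e 3))"
    unfolding Q_def
    by (intro definable_pred_conj definable_pred_ball definable_pred_imp definable_pred_eq
        definable_rel_reindex[OF RD] definable_pred_eq_const definable_multiple[OF addD \<open>0 \<in> D\<close>]
        T(1)) (auto simp: D_def)
  note Zdef = definable_partial_hom_selections[OF addD this]
  have Zf: "partial_hom_selections k (Q a (f (multiple n a)))" for k a
    by (rule partial_hom_selections_of_hom[OF \<open>additive f\<close>]) (auto simp: Q_def Rf)
  have finQ: "finite {z. Q a y x z}" for a y x
    by (rule finite_subset[OF _ m(1)[of x]]) (auto simp: Q_def)
  have RZ: "R (multiple n a) y" if sel: "partial_hom_selections (Suc k) (Q a y)" for k a y
  proof -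
    obtain v where "\<forall>i<Suc k. Q a y (multiple n a) (v i)"
      using sel by (rule partial_hom_selectionsE)
    then have "Q a y (multiple n a) (v 0)" by simp
    then show ?thesis by (auto simp: Q_def)
  qed
  have "\<exists>k. \<forall>a y. partial_hom_selections k (Q a y) \<longrightarrow> y = f (multiple n a)"
  proof (rule ccontr)
    assume none: "\<not> ?thesis"
    (* P k a: the k-th approximation still admits a wrong value at the multiple n a. *)
    define P where
      "P k a \<longleftrightarrow> (\<exists>y. partial_hom_selections k (Q a y) \<and> y \<noteq> f (multiple n a))" for k a
    have "\<exists>a. \<forall>p\<in>range P. p a"
    proof (rule saturated_realizes[OF sat])
      show "finite (D \<union> C)" using \<open>finite D\<close> \<open>finite C\<close> by simp
      fix p assume "p \<in> range P"
      then obtain k where p: "p = P k" by blast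
      have mN: "definable_rel N (D \<union> C) (\<lambda>x y. y = multiple n x)"
        using definable_pred_zero_expansion[OF exp definable_multiple[OF addD \<open>0 \<in> D\<close>]]
        by (rule definable_pred_mono) simp
      have fN': "definable_rel N (D \<union> C) (\<lambda>x y. y = f x)"
        using fN by (rule definable_pred_mono) simp
      have ZN: "definable_rel N (D \<union> C) (\<lambda>a y. partial_hom_selections k (Q a y))"
        using definable_pred_zero_expansion[OF exp Zdef] by (rule definable_pred_mono) simp
      have "P k a \<longleftrightarrow> (\<exists>v :: nat \<Rightarrow> 'a. partial_hom_selections k (Q a (v 0)) \<and>
          v 1 = multiple n a \<and> v 2 = f (v 1) \<and> \<not> v 0 = v 2)" for a
      proof
        assume "P k a"
        then obtain y where "partial_hom_selections k (Q a y)" "y \<noteq> f (multiple n a)"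
          unfolding P_def by blast
        then show "\<exists>v :: nat \<Rightarrow> 'a. partial_hom_selections k (Q a (v 0)) \<and>
            v 1 = multiple n a \<and> v 2 = f (v 1) \<and> \<not> v 0 = v 2"
          by (intro exI[of _ "(\<lambda>_. undefined)(0 := y, 1 := multiple n a, 2 := f (multiple n a))"])
             simp
      qed (auto simp: P_def)
      then have p': "p = (\<lambda>a. \<exists>v :: nat \<Rightarrow> 'a. partial_hom_selections k (Q a (v 0)) \<and>
          v 1 = multiple n a \<and> v 2 = f (v 1) \<and> \<not> v 0 = v 2)"
        unfolding p by (rule ext)
      show "definable_pred N (D \<union> C) (\<lambda>e :: nat \<Rightarrow> 'a. p (e 0))"
        unfolding p'
        by (intro definable_pred_ex definable_pred_conj definable_pred_not definable_pred_eq
            definable_rel_reindex[OF mN] definable_rel_reindex[OF fN'] definable_rel_reindex[OF ZN])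
    next
      fix \<Q> assume "\<Q> \<subseteq> range P" "finite \<Q>"
      from finite_subset_image[OF this(2,1)]
      obtain K where K: "K \<subseteq> UNIV" "finite K" "\<Q> = P ` K"
        by (elim exE conjE) (rule that)
      obtain a y where "partial_hom_selections (Max (insert 0 K)) (Q a y)" "y \<noteq> f (multiple n a)"
        using none by blast
      moreover have "k \<le> Max (insert 0 K)" if "k \<in> K" for k
        using that K(2) by (intro Max_ge) auto
      ultimately have "P k a" if "k \<in> K" for k
        unfolding P_def using partial_hom_selections_antimono that by blast
      then show "\<exists>a. \<forall>p\<in>\<Q>. p a" unfolding K(3) by blast
    qed
    then obtain a where a: "\<And>k. P k a" by blast
    (* The wrong value may depend on k, but all of them lie in one finite fibre of R and the
       approximations get stronger with k, so some value is wrong for all k. *)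
    have "\<exists>y. y \<noteq> f (multiple n a) \<and> (\<forall>k. partial_hom_selections k (Q a y))"
    proof (rule ccontr)
      assume "\<not> ?thesis"
      then have "\<forall>y. \<exists>k. y \<noteq> f (multiple n a) \<longrightarrow> \<not> partial_hom_selections k (Q a y)"
        by blast
      then obtain k where k: "\<And>y. y \<noteq> f (multiple n a) \<Longrightarrow> \<not> partial_hom_selections (k y) (Q a y)"
        by metis
      define K where "K = Max (insert 0 (k ` {y. R (multiple n a) y}))"
      obtain y where y: "partial_hom_selections (Suc K) (Q a y)" "y \<noteq> f (multiple n a)"
        using a[of "Suc K"] unfolding P_def by blast
      have "k y \<le> K"
        unfolding K_def using RZ[OF y(1)] m(1) by (intro Max_ge) auto
      then show False
        using k[OF y(2)] partial_hom_selections_antimono[OF y(1)] by simp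
    qed
    then obtain y where y: "y \<noteq> f (multiple n a)" "\<And>k. partial_hom_selections k (Q a y)"
      by blast
    obtain u where u: "additive u" "\<And>x. Q a y x (u x)"
      using hom_of_partial_hom_selections[OF finQ y(2)] by blast
    have "u (multiple n a) = f (multiple n a)"
      using u by (intro T(2)[rule_format]) (auto simp: Q_def)
    moreover have "u (multiple n a) = y"
      using u(2)[of "multiple n a"] by (simp add: Q_def)
    ultimately show False using y(1) by simp
  qed
  then obtain k where "\<And>a y. partial_hom_selections k (Q a y) \<longleftrightarrow> y = f (multiple n a)"
    using Zf by blast
  then have "definable_rel M D (\<lambda>a y. y = f (multiple n a))"
    using Zdef[of k] by simp
  with n show ?thesis by (rule that)
qed

text \<open>
  This is where small quotients enter: each \<open>x\<close> is \<open>g + na\<close> with \<open>g\<close> from a finite set of coset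
  representatives, and \<open>f x = f g + f (na)\<close> with parameters \<open>f g\<close>.
\<close>

lemma definable_of_definable_on_multiples:
  fixes M :: "('g, 's, 'a::ab_group_add) fo_structure"
  assumes "small_quotients TYPE('a)" "n \<ge> 1" and add_M: "definable_add M UNIV"
    and "additive f" and f: "definable_rel M UNIV (\<lambda>a y. y = f (multiple n a))"
  shows "definable_map M f"
proof -
  interpret additive f by fact
  obtain G0 :: "'a set" where G0: "finite G0" "\<And>x. \<exists>g\<in>G0. \<exists>a. x = g + multiple n a"
    using finite_coset_representatives[OF assms(1,2)] by blast
  let ?P = "\<lambda>x y g (v :: nat \<Rightarrow> 'a). v 1 = multiple n (v 0) \<and> v 2 = g \<and> v 2 + v 1 = x \<and>
      v 3 = f (multiple n (v 0)) \<and> v 4 = f g \<and> v 4 + v 3 = y"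
  have "(y = f x) = (\<exists>g\<in>G0. \<exists>v :: nat \<Rightarrow> 'a. ?P x y g v)" for x y
  proof
    assume "y = f x"
    obtain g a where g: "g \<in> G0" "x = g + multiple n a" using G0(2) by blast
    then have "?P x y g ((\<lambda>_. undefined)(0 := a, 1 := multiple n a, 2 := g,
            3 := f (multiple n a), 4 := f g))"
      using \<open>y = f x\<close> by (simp add: add)
    then show "\<exists>g\<in>G0. \<exists>v :: nat \<Rightarrow> 'a. ?P x y g v"
      using g(1) by blast
  next
    assume "\<exists>g\<in>G0. \<exists>v :: nat \<Rightarrow> 'a. ?P x y g v"
    then obtain g v where v: "?P x y g v" by blast
    then have "x = g + multiple n (v 0)" "y = f g + f (multiple n (v 0))" by auto
    then show "y = f x" by (simp only: add)
  qed
  then have eq: "(\<lambda>x y. y = f x) = (\<lambda>x y. \<exists>g\<in>G0. \<exists>v :: nat \<Rightarrow> 'a. ?P x y g v)"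
    by (intro ext)
  have "definable_rel M UNIV (\<lambda>x y. \<exists>g\<in>G0. \<exists>v :: nat \<Rightarrow> 'a. ?P x y g v)"
    by (intro definable_pred_bex G0(1) definable_pred_ex definable_pred_conj
        definable_pred_eq_const definable_rel_reindex[OF f] definable_add_reindex[OF add_M]
        definable_multiple[OF add_M] UNIV_I)
  then show ?thesis
    unfolding definable_map_iff by (rule back_subst[of "definable_rel M UNIV", OF _ eq[symmetric]])
qed

lemma definable_map_of_algebraic:
  fixes N :: "('f, 'r, 'a::ab_group_add) fo_structure" and M :: "('g, 's, 'a) fo_structure"
  assumes sat: "omega_saturated N" and exp: "is_zero_expansion N M"
    and grp: "is_expansion M (group_structure :: (unit, unit, 'a) fo_structure)"
    and quot: "small_quotients TYPE('a)"
    and "additive f" "definable_map N f" "finite F" and acl: "\<And>g. f g \<in> acl M (F \<union> {g})"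
  shows "definable_map M f"
proof -
  have add: "definable_add M UNIV"
    using grp by (rule definable_add_expansion)
  then obtain B where B: "finite B" "definable_add M B"
    by (rule definable_pred_finite_params)
  obtain C where C: "finite C" "definable_rel N C (\<lambda>x y. y = f x)"
    using assms(6) unfolding definable_map_iff by (rule definable_pred_finite_params)
  obtain R where R: "R \<in> bounded_rels M F" "\<And>x. R x (f x)"
    using uniformly_algebraic[OF sat exp \<open>finite F\<close> C acl] by blast
  define A where "A = insert 0 (F \<union> B)"
  have A: "finite A" "definable_add M A" "0 \<in> A" "R \<in> bounded_rels M A"
    using B R(1) \<open>finite F\<close> unfolding A_def bounded_rels_def by (auto intro: definable_pred_mono)
  obtain n D where n: "n \<ge> 1" "definable_rel M D (\<lambda>a y. y = f (multiple n a))"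
    by (rule definable_on_multiples[where f = f and R = R,
          OF sat exp A(1-3) C \<open>additive f\<close> A(4) R(2)])
  then have "definable_rel M UNIV (\<lambda>a y. y = f (multiple n a))"
    by (auto intro: definable_pred_mono)
  with quot n(1) add \<open>additive f\<close> show ?thesis
    by (rule definable_of_definable_on_multiples)
qed

text \<open>
  Reduces the second part of the theorem to the first: the parameters of a definition of \<open>f\<close>
  serve as the finite set \<open>F\<close>.
\<close>

lemma definable_map_imp_dcl:
  assumes "definable_map N f"
  obtains F where "finite F" "\<And>g. f g \<in> dcl N (F \<union> {g})"
proof -
  obtain F where F: "finite F" "definable_rel N F (\<lambda>x y. y = f x)"
    using assms unfolding definable_map_iff by (rule definable_pred_finite_params)
  have "f g \<in> dcl N (F \<union> {g})" for g
  proof -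
    have "definable_rel N (F \<union> {g}) (\<lambda>x y. y = f x)"
      using F(2) by (rule definable_pred_mono) blast
    then have "definable_pred N (F \<union> {g}) (\<lambda>e. e (Some (0 :: nat)) = f (e None))"
      by (rule definable_rel_reindex)
    from definable_pred_param[OF this, of g]
    have "definable_pred N (F \<union> {g}) (\<lambda>e. map e [0..<1] \<in> {[f g]})"
      by simp
    then have "definable_over N (F \<union> {g}) 1 {[f g]}"
      by (rule definable_pred_imp_definable_over) auto
    then show ?thesis unfolding dcl_def by blast
  qed
  with F(1) show ?thesis by (rule that)
qed

theorem lemma1p4:
  fixes N :: "('f, 'r, 'a::ab_group_add) fo_structure"
    and M :: "('g, 's, 'a) fo_structure"
  assumes "omega_saturated N"
    and "is_zero_expansion N M"
    and "is_expansion M (group_structure :: (unit, unit, 'a) fo_structure)"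
    and "small_quotients TYPE('a)"
  shows "(\<forall>f :: 'a \<Rightarrow> 'a. additive f \<longrightarrow> definable_map N f \<longrightarrow>
            (\<exists>F. finite F \<and> (\<forall>g. f g \<in> acl M (F \<union> {g}))) \<longrightarrow>
            definable_map M f) \<and>
         ((\<forall>A. dcl N A \<subseteq> acl M A) \<longrightarrow>
            (\<forall>f :: 'a \<Rightarrow> 'a. additive f \<longrightarrow> definable_map N f \<longrightarrow> definable_map M f))"
proof (intro conjI allI impI)
  fix f :: "'a \<Rightarrow> 'a"
  assume "additive f" "definable_map N f" "\<exists>F. finite F \<and> (\<forall>g. f g \<in> acl M (F \<union> {g}))"
  then show "definable_map M f"
    using definable_map_of_algebraic[OF assms] by blast
next
  fix f :: "'a \<Rightarrow> 'a"
  assume dcl: "\<forall>A. dcl N A \<subseteq> acl M A" and f: "additive f" "definable_map N f"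
  obtain F where "finite F" "\<And>g. f g \<in> dcl N (F \<union> {g})"
    using definable_map_imp_dcl[OF f(2)] by blast
  then show "definable_map M f"
    using definable_map_of_algebraic[OF assms f] dcl by blast
qed

end
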